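(* For rule $12$ on the triangular grid, the problem \textsc{Stability} is in $\mathbf{NC}$.
   Context: Triangular grid: the plane tessellated by equilateral triangles; each triangle (cell) has three neighbors, namely the triangles sharing an edge with it; $N(u)$ denotes the set of neighbors of $u$. A configuration assigns to every cell a state in $\{0,1\}$ (1 = active, 0 = inactive). A freezing totalistic cellular automaton is given by a set $\mathcal{I}\subseteq\{1,2,3\}$ and acts synchronously by $F(c)_u=1$ if $c_u=1$ or $\sum_{v\in N(u)}c_v\in\mathcal{I}$, and $F(c)_u=0$ otherwise; rule $12$ means $\mathcal{I}=\{1,2\}$. A finite configuration $x$ of dimension $n\times n$ assigns states to a rhombus-shaped region of $2n^2$ triangles, and $c(x)$ is the periodic configuration obtained by repeating $x$ in all directions (a torus). A cell $u$ with $c_u=0$ is stable for $c$ if $F^t(c)_u=0$ for all $t\ge0$. \textsc{Stability}: given $x$ and a cell $u$ of the region with $x_u=0$, decide whether $u$ is stable for $c(x)$. $\mathbf{NC}$ is the class of decision problems solvable on a PRAM in time $(\log n)^{O(1)}$ with $n^{O(1)}$ processors. *)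

theory Defs
  imports Complex_Main "HOL-Library.Landau_Symbols"
begin

text \<open>
  The plane is cut into unit rhombi, the one with lower left corner \<open>(i, j)\<close> (in the lattice
  basis of two unit vectors at angle 60 degrees) consisting of the triangles \<open>Up i j\<close> and
  \<open>Down i j\<close>.
\<close>

datatype cell = Up int int | Down int int

fun corners :: "cell \<Rightarrow> (int \<times> int) set" where
  "corners (Up i j) = {(i, j), (i + 1, j), (i, j + 1)}"
| "corners (Down i j) = {(i + 1, j), (i, j + 1), (i + 1, j + 1)}"

text \<open>Two distinct triangles share an edge iff they have exactly two corners in common.\<close>

definition neighbors :: "cell \<Rightarrow> cell set" where
  "neighbors u = {v. card (corners u \<inter> corners v) = 2}"

lemma neighbors_eq:
  "neighbors (Up i j) = {Down i j, Down (i - 1) j, Down i (j - 1)}"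
  "neighbors (Down i j) = {Up i j, Up (i + 1) j, Up i (j + 1)}"
proof -
  have eq: "A = B" if "\<And>k l. (Up k l \<in> A) = (Up k l \<in> B)" "\<And>k l. (Down k l \<in> A) = (Down k l \<in> B)"
    for A B :: "cell set"
    by (rule set_eqI) (metis cell.exhaust that)
  show "neighbors (Up i j) = {Down i j, Down (i - 1) j, Down i (j - 1)}"
    by (rule eq) (auto simp: neighbors_def Int_insert_left card_insert_if split: if_splits)
  show "neighbors (Down i j) = {Up i j, Up (i + 1) j, Up i (j + 1)}"
    by (rule eq) (auto simp: neighbors_def Int_insert_left card_insert_if split: if_splits)
qed

type_synonym configuration = "cell \<Rightarrow> bool"  \<comment> \<open>\<open>True\<close> is the active state 1\<close>

definition ftca :: "nat set \<Rightarrow> configuration \<Rightarrow> configuration" where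
  "ftca I c u \<longleftrightarrow> c u \<or> (\<Sum>v\<in>neighbors u. of_bool (c v)) \<in> I"

definition stable :: "nat set \<Rightarrow> configuration \<Rightarrow> cell \<Rightarrow> bool" where
  "stable I c u \<longleftrightarrow> (\<forall>t. \<not> (ftca I ^^ t) c u)"

definition region :: "nat \<Rightarrow> cell list" where
  "region n = [u. i \<leftarrow> [0..int n - 1], j \<leftarrow> [0..int n - 1], u \<leftarrow> [Up i j, Down i j]]"

text \<open>
  A finite configuration of dimension \<open>n \<times> n\<close> is given by a function of which only the values on
  \<^term>\<open>region n\<close> are used.
\<close>

fun periodic :: "nat \<Rightarrow> (cell \<Rightarrow> bool) \<Rightarrow> configuration" where
  "periodic n x (Up i j) = x (Up (i mod int n) (j mod int n))"
| "periodic n x (Down i j) = x (Down (i mod int n) (j mod int n))"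

text \<open>
  An instance is written as the dimension in unary, then the \<open>2 n\<^sup>2\<close> states of \<open>x\<close>, then
  \<open>2 n\<^sup>2\<close> bits marking the position of \<open>u\<close>; its length is \<open>4 n\<^sup>2 + n + 1\<close>.
  Words that do not encode an instance are not in the language.
\<close>

definition encode :: "nat \<Rightarrow> (cell \<Rightarrow> bool) \<Rightarrow> cell \<Rightarrow> bool list" where
  "encode n x u =
     replicate n True @ [False] @ map x (region n) @ map (\<lambda>v. v = u) (region n)"

definition STABILITY :: "nat set \<Rightarrow> bool list set" where
  "STABILITY I =
     {encode n x u | n x u. u \<in> set (region n) \<and> \<not> x u \<and> stable I (periodic n x) u}"

text \<open>
  In all instructions the arguments are register numbers, except for the constant in \<open>Const\<close>
  and the jump target in \<open>JumpIfZero\<close>. There is deliberately no multiplication: with these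
  instructions a value produced within \<open>t\<close> steps has \<open>O(t + log n)\<close> bits, so that the words
  are unbounded but charging unit cost for an instruction is harmless.
\<close>

datatype instr =
    Const nat nat
  | Add nat nat nat
  | Sub nat nat nat
  | Div nat nat nat
  | Mod nat nat nat
  | Load nat nat
  | Store nat nat
  | JumpIfZero nat nat

type_synonym program = "instr list"

fun exec_reg :: "(nat \<Rightarrow> nat) \<Rightarrow> instr \<Rightarrow> (nat \<Rightarrow> nat) \<Rightarrow> (nat \<Rightarrow> nat)" where
  "exec_reg m (Const r k) R = R(r := k)"
| "exec_reg m (Add r a b) R = R(r := R a + R b)"
| "exec_reg m (Sub r a b) R = R(r := R a - R b)"
| "exec_reg m (Div r a b) R = R(r := R a div R b)"
| "exec_reg m (Mod r a b) R = R(r := R a mod R b)"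
| "exec_reg m (Load r a) R = R(r := m (R a))"
| "exec_reg m (Store a b) R = R"
| "exec_reg m (JumpIfZero a l) R = R"

fun exec_pc :: "instr \<Rightarrow> (nat \<Rightarrow> nat) \<Rightarrow> nat \<Rightarrow> nat" where
  "exec_pc (JumpIfZero a l) R i = (if R a = 0 then l else Suc i)"
| "exec_pc _ R i = Suc i"

fun exec_write :: "instr \<Rightarrow> (nat \<Rightarrow> nat) \<Rightarrow> (nat \<times> nat) option" where
  "exec_write (Store a b) R = Some (R a, R b)"
| "exec_write _ R = None"

record pram_state =
  pc :: "nat \<Rightarrow> nat"
  reg :: "nat \<Rightarrow> nat \<Rightarrow> nat"
  mem :: "nat \<Rightarrow> nat"

text \<open>
  In \<open>pc s p\<close> and \<open>reg s p\<close> the number \<open>p\<close> is that of a processor; with \<open>P\<close> processors only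
  those with \<open>p < P\<close> take part. A processor halts by leaving the program.
\<close>

definition active :: "program \<Rightarrow> nat \<Rightarrow> pram_state \<Rightarrow> nat \<Rightarrow> bool" where
  "active prog P s p \<longleftrightarrow> p < P \<and> pc s p < length prog"

definition write_request ::
    "program \<Rightarrow> nat \<Rightarrow> pram_state \<Rightarrow> nat \<Rightarrow> (nat \<times> nat) option" where
  "write_request prog P s p =
     (if active prog P s p then exec_write (prog ! pc s p) (reg s p) else None)"

text \<open>
  One synchronous step. All reads see the old shared memory. Concurrent reads and writes are
  allowed, and of several processors writing to the same address the one with the least number
  succeeds. (The choice of the access convention does not affect the class \<open>NC\<close>, as the
  usual ones simulate each other with logarithmic slowdown and polynomially many processors.)
\<close>

definition pram_step :: "program \<Rightarrow> nat \<Rightarrow> pram_state \<Rightarrow> pram_state" where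
  "pram_step prog P s =
     \<lparr>pc = (\<lambda>p. if active prog P s p then exec_pc (prog ! pc s p) (reg s p) (pc s p) else pc s p),
      reg = (\<lambda>p. if active prog P s p then exec_reg (mem s) (prog ! pc s p) (reg s p) else reg s p),
      mem = (\<lambda>a. if \<exists>p v. write_request prog P s p = Some (a, v)
                 then snd (the (write_request prog P s
                                  (LEAST p. \<exists>v. write_request prog P s p = Some (a, v))))
                 else mem s a)\<rparr>"

text \<open>
  Initially every processor has its number in register 0 and the length of the input in
  register 1, and the shared memory holds one input bit per address.
\<close>

definition pram_init :: "bool list \<Rightarrow> pram_state" where
  "pram_init w =
     \<lparr>pc = (\<lambda>p. 0),
      reg = (\<lambda>p. (\<lambda>r. 0)(0 := p, 1 := length w)),
      mem = (\<lambda>a. if a < length w \<and> w ! a then 1 else 0)\<rparr>"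

definition pram_run :: "program \<Rightarrow> nat \<Rightarrow> bool list \<Rightarrow> nat \<Rightarrow> pram_state" where
  "pram_run prog P w t = (pram_step prog P ^^ t) (pram_init w)"

definition pram_decides ::
    "program \<Rightarrow> (nat \<Rightarrow> nat) \<Rightarrow> (nat \<Rightarrow> nat) \<Rightarrow> bool list set \<Rightarrow> bool" where
  "pram_decides prog P T L \<longleftrightarrow>
     (\<forall>w. \<exists>t \<le> T (length w).
        let s = pram_run prog (P (length w)) w t
        in (\<forall>p. \<not> active prog (P (length w)) s p) \<and> (mem s 0 = 1 \<longleftrightarrow> w \<in> L))"

text \<open>
  The number of processors is a fixed polynomial in the input length rather than an arbitrary
  polynomially bounded function, because the latter could provide non-uniform advice.
\<close>

definition NC :: "bool list set set" where
  "NC = {L. \<exists>prog k T. (\<lambda>n. real (T n)) \<in> O(\<lambda>n. ln (real n) ^ k) \<and>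
                       pram_decides prog (\<lambda>n. (n + 1) ^ k) T L}"

end

theory Submission imports Defs begin

text \<open>
  In the coordinates \<open>(i, j, - i - j)\<close> of \<open>Up i j\<close> and \<open>(i, j, - i - j - 1)\<close> of \<open>Down i j\<close>
  neighbors differ by one in a single coordinate, and the distance of cells in the grid is the
  \<open>\<ell>\<^sub>1\<close> distance. Under rule 12 a cell at distance \<open>d > 0\<close> from the active cells stays inactive
  before time \<open>d\<close>, and it becomes active at time \<open>d\<close> unless all of its neighbors are active at
  time \<open>d - 1\<close>. The latter happens iff all of them are at distance \<open>d - 1\<close>, and then the cell is
  stable. So an inactive cell is stable iff it is a strict local maximum of the distance to the
  active cells, or if there are none of these. As the distance to a given cell is an explicit
  expression, a PRAM with concurrent writing checks this condition in constant time by trying all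
  pairs of an active cell and a distance in parallel.
\<close>

section \<open>Stability and distance to the active cells\<close>

text \<open>Activity is never delayed because the cell that is about to be reached is itself the
  inactive neighbor needed by the cell before it: while \<open>u\<close> is inactive, no neighbor of
  \<open>u\<close> can be blocked by three active neighbors. Distances are taken in the unrolled
  periodic plane, where they are explicit, and not on the torus. A bounded window suffices, since
  each active cell has a copy within distance \<open>4 n\<close> of \<open>u\<close>. Different
  neighbors of \<open>u\<close> may be closer to different active cells, so being a strict local
  maximum splits into three existential statements, one per coordinate axis, about the active cells
  at least distance. Each of them is one concurrent write, and the priority of low processor numbers
  provides the minimum. The missing multiplication is circumvented by division, and case
  distinctions are made arithmetically, without jumps.\<close>

fun cell_x :: "cell \<Rightarrow> int" where
  "cell_x (Up i j) = i"
| "cell_x (Down i j) = i"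

fun cell_y :: "cell \<Rightarrow> int" where
  "cell_y (Up i j) = j"
| "cell_y (Down i j) = j"

fun cell_z :: "cell \<Rightarrow> int" where
  "cell_z (Up i j) = - i - j"
| "cell_z (Down i j) = - i - j - 1"

definition cell_dist :: "cell \<Rightarrow> cell \<Rightarrow> nat" where
  "cell_dist u v =
     nat (\<bar>cell_x u - cell_x v\<bar> + \<bar>cell_y u - cell_y v\<bar> + \<bar>cell_z u - cell_z v\<bar>)"

text \<open>A bound is used in place of the distance itself, as there may be no active cell at
  all.\<close>

definition near :: "configuration \<Rightarrow> nat \<Rightarrow> cell \<Rightarrow> bool" where
  "near c d u \<longleftrightarrow> (\<exists>a. c a \<and> cell_dist u a \<le> d)"

lemma finite_neighbors [simp]: "finite (neighbors u)"
  by (cases u) (auto simp: neighbors_eq)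

lemma neighbors_sym: "v \<in> neighbors u \<longleftrightarrow> u \<in> neighbors v"
  by (simp add: neighbors_def Int_commute)

lemma card_neighbors: "card (neighbors u) = 3"
  by (cases u) (auto simp: neighbors_eq)

lemma int_cell_dist:
  "int (cell_dist u v) =
     \<bar>cell_x u - cell_x v\<bar> + \<bar>cell_y u - cell_y v\<bar> + \<bar>cell_z u - cell_z v\<bar>"
  unfolding cell_dist_def by (rule nat_0_le) simp

lemma cell_dist_self [simp]: "cell_dist u u = 0"
  by (simp add: cell_dist_def)

lemma cell_dist_eq_0: "cell_dist u v = 0 \<longleftrightarrow> u = v"
proof
  assume "cell_dist u v = 0"
  then have eq: "cell_x u = cell_x v" "cell_y u = cell_y v" "cell_z u = cell_z v"
    using int_cell_dist[of u v] by linarith+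
  show "u = v"
    using eq by (cases u; cases v) auto
qed simp

text \<open>Each neighbor of an up triangle arises by lowering one coordinate by 1, which brings it
  closer to \<open>a\<close> exactly if \<open>a\<close> is strictly smaller there. For down
  triangles a coordinate is raised.\<close>

lemma cell_dist_step_Up:
  "int (cell_dist (Down (i - 1) j) a) =
     int (cell_dist (Up i j) a) + (if cell_x a < cell_x (Up i j) then -1 else 1)"
  "int (cell_dist (Down i (j - 1)) a) =
     int (cell_dist (Up i j) a) + (if cell_y a < cell_y (Up i j) then -1 else 1)"
  "int (cell_dist (Down i j) a) =
     int (cell_dist (Up i j) a) + (if cell_z a < cell_z (Up i j) then -1 else 1)"
  by (simp_all add: int_cell_dist)

lemma cell_dist_step_Down:
  "int (cell_dist (Up (i + 1) j) a) =
     int (cell_dist (Down i j) a) + (if cell_x (Down i j) < cell_x a then -1 else 1)"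
  "int (cell_dist (Up i (j + 1)) a) =
     int (cell_dist (Down i j) a) + (if cell_y (Down i j) < cell_y a then -1 else 1)"
  "int (cell_dist (Up i j) a) =
     int (cell_dist (Down i j) a) + (if cell_z (Down i j) < cell_z a then -1 else 1)"
  by (simp_all add: int_cell_dist)

lemma cell_dist_neighbor:
  assumes "v \<in> neighbors u"
  shows "cell_dist u a \<le> Suc (cell_dist v a)"
proof (cases u)
  case (Up i j)
  with assms consider "v = Down i j" | "v = Down (i - 1) j" | "v = Down i (j - 1)"
    by (auto simp: neighbors_eq)
  then show ?thesis
    unfolding Up using cell_dist_step_Up[of i j a] by cases (auto split: if_splits)
next
  case (Down i j)
  with assms consider "v = Up i j" | "v = Up (i + 1) j" | "v = Up i (j + 1)"
    by (auto simp: neighbors_eq)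
  then show ?thesis
    unfolding Down using cell_dist_step_Down[of i j a] by cases (auto split: if_splits)
qed

text \<open>The coordinates of an up triangle add up to 0 and those of a down triangle to -1. Hence
  a cell other than the up triangle \<open>u\<close> is smaller in some coordinate, and one other
  than a down triangle \<open>u\<close> is larger in some coordinate; the neighbor in that direction
  is closer.\<close>

lemma cell_dist_closer:
  assumes "cell_dist u a = Suc d"
  obtains v where "v \<in> neighbors u" "cell_dist v a = d"
proof (cases u)
  case (Up i j)
  have "u \<noteq> a"
    using assms by auto
  then consider "cell_x a < cell_x u" | "cell_y a < cell_y u" | "cell_z a < cell_z u"
    using Up by (cases a) fastforce+
  then have "cell_dist (Down (i - 1) j) a = d \<or> cell_dist (Down i (j - 1)) a = d \<or> cell_dist (Down i j) a = d"
    using assms cell_dist_step_Up[of i j a] unfolding Up by cases (simp_all only: if_True, linarith+)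
  moreover have "neighbors u = {Down i j, Down (i - 1) j, Down i (j - 1)}"
    unfolding Up by (rule neighbors_eq)
  ultimately show ?thesis
    using that by blast
next
  case (Down i j)
  have "u \<noteq> a"
    using assms by auto
  then consider "cell_x u < cell_x a" | "cell_y u < cell_y a" | "cell_z u < cell_z a"
    using Down by (cases a) fastforce+
  then have "cell_dist (Up (i + 1) j) a = d \<or> cell_dist (Up i (j + 1)) a = d \<or> cell_dist (Up i j) a = d"
    using assms cell_dist_step_Down[of i j a] unfolding Down by cases (simp_all only: if_True, linarith+)
  moreover have "neighbors u = {Up i j, Up (i + 1) j, Up i (j + 1)}"
    unfolding Down by (rule neighbors_eq)
  ultimately show ?thesis
    using that by blast
qed

lemma near_mono: "near c d u \<Longrightarrow> d \<le> e \<Longrightarrow> near c e u"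
  unfolding near_def using le_trans by blast

lemma near_neighbor: "v \<in> neighbors u \<Longrightarrow> near c d v \<Longrightarrow> near c (Suc d) u"
  unfolding near_def using cell_dist_neighbor
  by (meson Suc_le_mono le_trans)

lemma near_Suc_neighbor:
  assumes "near c (Suc d) u" "\<not> near c d u"
  obtains v where "v \<in> neighbors u" "near c d v"
proof -
  from assms obtain a where a: "c a" "cell_dist u a = Suc d"
    unfolding near_def by (meson le_Suc_eq)
  then show ?thesis
    using cell_dist_closer that unfolding near_def by (metis order_refl)
qed

section \<open>Time evolution under rule 12\<close>

lemma sum_of_bool_neighbors:
  "(\<Sum>v\<in>neighbors u. of_bool (c v)) = card {v \<in> neighbors u. c v}"
  by (simp add: Int_def)

lemma ftca_12:
  "ftca {1, 2} c u \<longleftrightarrow> c u \<or> (\<exists>v\<in>neighbors u. c v) \<and> (\<exists>v\<in>neighbors u. \<not> c v)"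
proof -
  let ?A = "{v \<in> neighbors u. c v}"
  have fin: "finite ?A" by simp
  have le: "card ?A \<le> 3"
    using card_mono[of "neighbors u" ?A] by (simp add: card_neighbors)
  have none: "card ?A = 0 \<longleftrightarrow> \<not> (\<exists>v\<in>neighbors u. c v)"
    using fin by auto
  have "card ?A = 3 \<longleftrightarrow> ?A = neighbors u"
    using card_subset_eq[of "neighbors u" ?A] card_neighbors[of u] by auto
  then have all: "card ?A = 3 \<longleftrightarrow> \<not> (\<exists>v\<in>neighbors u. \<not> c v)"
    by blast
  have "n \<in> {1, 2} \<longleftrightarrow> n \<noteq> 0 \<and> n \<noteq> 3" if "n \<le> 3" for n :: nat
    using that by auto
  note this[OF le]
  then show ?thesis
    unfolding ftca_def sum_of_bool_neighbors none all by blast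
qed

definition active_at :: "nat \<Rightarrow> configuration \<Rightarrow> configuration" where
  "active_at t c = (ftca {1, 2} ^^ t) c"

lemma active_at_0 [simp]: "active_at 0 c = c"
  by (simp add: active_at_def)

lemma active_at_Suc:
  "active_at (Suc t) c u \<longleftrightarrow> active_at t c u \<or>
     (\<exists>v\<in>neighbors u. active_at t c v) \<and> (\<exists>v\<in>neighbors u. \<not> active_at t c v)"
  unfolding active_at_def funpow.simps comp_apply by (rule ftca_12)

lemma stable_12_active_at: "stable {1, 2} c u \<longleftrightarrow> (\<forall>t. \<not> active_at t c u)"
  unfolding stable_def active_at_def ..

lemma active_at_mono: "active_at s c u \<Longrightarrow> s \<le> t \<Longrightarrow> active_at t c u"
  by (induction t) (auto simp: le_Suc_eq active_at_Suc)

lemma active_at_near: "active_at t c u \<Longrightarrow> near c t u"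
proof (induction t arbitrary: u)
  case 0
  then show ?case
    unfolding near_def by (intro exI[of _ u]) simp
next
  case (Suc t)
  from Suc.prems consider "active_at t c u"
    | v where "v \<in> neighbors u" "active_at t c v"
    by (auto simp: active_at_Suc)
  then show ?case
    using Suc.IH near_mono[of c t u "Suc t"] near_neighbor by cases auto
qed

text \<open>
  A cell on a shortest path to an active cell has an inactive neighbor, namely its predecessor
  on the path, so the path is traversed without delay.
\<close>

lemma active_at_neighbor:
  assumes "near c (Suc d) u" "\<not> near c d u"
  shows "\<exists>v\<in>neighbors u. active_at d c v"
  using assms
proof (induction d arbitrary: u)
  case 0
  then obtain v where "v \<in> neighbors u" "near c 0 v"
    using near_Suc_neighbor by blast
  then show ?case
    by (auto simp: near_def cell_dist_eq_0)
next
  case (Suc d)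
  then obtain v where v: "v \<in> neighbors u" "near c (Suc d) v"
    using near_Suc_neighbor by blast
  have "\<not> near c d v"
    using Suc.prems(2) v(1) near_neighbor by blast
  with Suc.IH v(2) have "\<exists>w\<in>neighbors v. active_at d c w"
    by blast
  moreover have "\<not> active_at d c u"
    using Suc.prems(2) active_at_near near_mono by (metis le_Suc_eq order_refl)
  ultimately have "active_at (Suc d) c v"
    using v(1) neighbors_sym by (auto simp: active_at_Suc)
  with v(1) show ?case
    by blast
qed

text \<open>Up to time \<open>d\<close> the cell \<open>u\<close> is out of reach, and at time
  \<open>d\<close> exactly the neighbors within distance \<open>d\<close> are active. If one is
  missing, the rule fires at the next step; otherwise the count is 3 from then on and
  \<open>u\<close> is blocked for ever.\<close>

theorem stable_12_iff:
  assumes "near c (Suc d) u" "\<not> near c d u"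
  shows "stable {1, 2} c u \<longleftrightarrow> (\<forall>v\<in>neighbors u. near c d v)"
proof
  assume st: "stable {1, 2} c u"
  have "active_at (Suc d) c u" if "v \<in> neighbors u" "\<not> near c d v" for v
    using active_at_neighbor[OF assms] active_at_near that
    by (auto simp: active_at_Suc)
  with st show "\<forall>v\<in>neighbors u. near c d v"
    unfolding stable_12_active_at by blast
next
  assume nb: "\<forall>v\<in>neighbors u. near c d v"
  have act: "active_at d c v" if v: "v \<in> neighbors u" for v
  proof (cases d)
    case 0
    with nb v show ?thesis
      by (auto simp: near_def cell_dist_eq_0)
  next
    case (Suc e)
    have "\<not> near c e v"
      using assms(2) v near_neighbor Suc by blast
    with nb v Suc have "\<exists>w\<in>neighbors v. active_at e c w"
      by (metis active_at_neighbor)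
    \<comment> \<open>Here \<open>u\<close> serves as the inactive neighbor of
      \<open>v\<close>.\<close>
    moreover have "\<not> active_at e c u"
      using assms(2) active_at_near near_mono Suc by (metis le_Suc_eq order_refl)
    ultimately show ?thesis
      using v neighbors_sym Suc by (auto simp: active_at_Suc)
  qed
  have "\<not> active_at t c u" for t
  proof (induction t)
    case 0
    then show ?case
      using assms(2) unfolding near_def by (metis active_at_0 cell_dist_self le0)
  next
    case (Suc t)
    show ?case
    proof (cases "t < d")
      case True
      then show ?thesis
        using assms(2) active_at_near near_mono by (metis Suc_leI)
    next
      case False
      then have "active_at t c v" if "v \<in> neighbors u" for v
        using act[OF that] active_at_mono[of d c v t] by simp
      with Suc show ?thesis
        by (auto simp: active_at_Suc)
    qed
  qed
  then show "stable {1, 2} c u"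
    unfolding stable_12_active_at by blast
qed

lemma stable_12_no_active:
  assumes "\<And>a. \<not> c a"
  shows "stable {1, 2} c u"
proof -
  have "\<not> active_at t c u" for t
    using active_at_near assms unfolding near_def by blast
  then show ?thesis
    unfolding stable_12_active_at by blast
qed

fun toward :: "(cell \<Rightarrow> int) \<Rightarrow> cell \<Rightarrow> cell \<Rightarrow> bool" where
  "toward f (Up i j) a \<longleftrightarrow> f a < f (Up i j)"
| "toward f (Down i j) a \<longleftrightarrow> f (Down i j) < f a"

text \<open>No active cell is closer to \<open>u\<close> than \<open>Suc d\<close>, so a neighbor
  comes within distance \<open>d\<close> only of an active cell at distance exactly
  \<open>Suc d\<close> that lies on its side.\<close>

lemma neighbors_near_iff:
  assumes "\<not> near c d u"
  shows "(\<forall>v\<in>neighbors u. near c d v) \<longleftrightarrow>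
         (\<forall>f\<in>{cell_x, cell_y, cell_z}. \<exists>a. c a \<and> cell_dist u a = Suc d \<and> toward f u a)"
proof -
  have far: "Suc d \<le> cell_dist u a" if "c a" for a
    using assms that unfolding near_def by (meson not_less_eq_eq)
  show ?thesis
  proof (cases u)
    case (Up i j)
    have *: "near c d v \<longleftrightarrow> (\<exists>a. c a \<and> cell_dist u a = Suc d \<and> f a < f u)"
      if "(v, f) \<in> {(Down (i - 1) j, cell_x), (Down i (j - 1), cell_y), (Down i j, cell_z)}" for v f
    proof -
      have "cell_dist v a \<le> d \<longleftrightarrow> cell_dist u a = Suc d \<and> f a < f u" if "c a" for a
        using far[OF that] \<open>(v, f) \<in> _\<close> Up cell_dist_step_Up[of i j a]
        by (auto simp del: cell_x.simps cell_y.simps cell_z.simps split: if_splits)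
      then show ?thesis
        unfolding near_def by blast
    qed
    show ?thesis
      using *[of "Down (i - 1) j" cell_x] *[of "Down i (j - 1)" cell_y] *[of "Down i j" cell_z] Up
      by (auto simp: neighbors_eq)
  next
    case (Down i j)
    have *: "near c d v \<longleftrightarrow> (\<exists>a. c a \<and> cell_dist u a = Suc d \<and> f u < f a)"
      if "(v, f) \<in> {(Up (i + 1) j, cell_x), (Up i (j + 1), cell_y), (Up i j, cell_z)}" for v f
    proof -
      have "cell_dist v a \<le> d \<longleftrightarrow> cell_dist u a = Suc d \<and> f u < f a" if "c a" for a
        using far[OF that] \<open>(v, f) \<in> _\<close> Down cell_dist_step_Down[of i j a]
        by (auto simp del: cell_x.simps cell_y.simps cell_z.simps split: if_splits)
      then show ?thesis
        unfolding near_def by blast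
    qed
    show ?thesis
      using *[of "Up (i + 1) j" cell_x] *[of "Up i (j + 1)" cell_y] *[of "Up i j" cell_z] Down
      by (auto simp: neighbors_eq)
  qed
qed

section \<open>Straight-line PRAM programs\<close>

definition sequential :: "instr \<Rightarrow> bool" where
  "sequential c \<longleftrightarrow> (\<forall>R i. exec_pc c R i = Suc i)"

definition silent :: "instr \<Rightarrow> bool" where
  "silent c \<longleftrightarrow> (\<forall>R. exec_write c R = None)"

lemma sequential_simps [simp]:
  "sequential (Const r k)" "sequential (Add r a b)" "sequential (Sub r a b)"
  "sequential (Div r a b)" "sequential (Mod r a b)" "sequential (Load r a)" "sequential (Store a b)"
  by (auto simp: sequential_def)

lemma silent_simps [simp]:
  "silent (Const r k)" "silent (Add r a b)" "silent (Sub r a b)"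
  "silent (Div r a b)" "silent (Mod r a b)" "silent (Load r a)"
  by (auto simp: silent_def)

text \<open>Code must exist for every target register \<open>r\<close>; registers 0 and 1 are
  reserved for the processor number and the input length. Preserving all registers below
  \<open>r\<close> allows them to be used as an evaluation stack.\<close>

definition expressible :: "((nat \<Rightarrow> nat) \<Rightarrow> nat \<Rightarrow> nat \<Rightarrow> nat) \<Rightarrow> bool" where
  "expressible f \<longleftrightarrow> (\<forall>r\<ge>2. \<exists>code. (\<forall>c\<in>set code. sequential c \<and> silent c) \<and>
     (\<forall>m R. fold (exec_reg m) code R r = f m (R 0) (R 1) \<and>
            (\<forall>s<r. fold (exec_reg m) code R s = R s)))"

definition expressible_pred :: "((nat \<Rightarrow> nat) \<Rightarrow> nat \<Rightarrow> nat \<Rightarrow> bool) \<Rightarrow> bool" where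
  "expressible_pred Q \<longleftrightarrow> expressible (\<lambda>m p l. of_bool (Q m p l))"

lemma expressible_const: "expressible (\<lambda>m p l. k)"
  unfolding expressible_def
proof (intro allI impI)
  fix r :: nat
  show "\<exists>code. (\<forall>c\<in>set code. sequential c \<and> silent c) \<and>
     (\<forall>m R. fold (exec_reg m) code R r = k \<and> (\<forall>s<r. fold (exec_reg m) code R s = R s))"
    by (rule exI[of _ "[Const r k]"]) auto
qed

lemma expressible_proc: "expressible (\<lambda>m p l. p)"
  unfolding expressible_def
proof (intro allI impI)
  fix r :: nat
  assume "2 \<le> r"
  then show "\<exists>code. (\<forall>c\<in>set code. sequential c \<and> silent c) \<and>
     (\<forall>m R. fold (exec_reg m) code R r = R 0 \<and> (\<forall>s<r. fold (exec_reg m) code R s = R s))"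
    by (intro exI[of _ "[Const r 0, Add r r 0]"]) auto
qed

lemma expressible_length: "expressible (\<lambda>m p l. l)"
  unfolding expressible_def
proof (intro allI impI)
  fix r :: nat
  assume "2 \<le> r"
  then show "\<exists>code. (\<forall>c\<in>set code. sequential c \<and> silent c) \<and>
     (\<forall>m R. fold (exec_reg m) code R r = R 1 \<and> (\<forall>s<r. fold (exec_reg m) code R s = R s))"
    by (intro exI[of _ "[Const r 0, Add r r 1]"]) auto
qed

lemma expressible_load:
  assumes "expressible f"
  shows "expressible (\<lambda>m p l. m (f m p l))"
  unfolding expressible_def
proof (intro allI impI)
  fix r :: nat
  assume "2 \<le> r"
  with assms obtain code where "\<forall>c\<in>set code. sequential c \<and> silent c"
    "\<forall>m R. fold (exec_reg m) code R r = f m (R 0) (R 1) \<and> (\<forall>s<r. fold (exec_reg m) code R s = R s)"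
    unfolding expressible_def by blast
  then show "\<exists>code. (\<forall>c\<in>set code. sequential c \<and> silent c) \<and>
     (\<forall>m R. fold (exec_reg m) code R r = m (f m (R 0) (R 1)) \<and>
            (\<forall>s<r. fold (exec_reg m) code R s = R s))"
    by (intro exI[of _ "code @ [Load r r]"]) auto
qed

text \<open>The first operand rests in \<open>r\<close> while the second is computed in
  \<open>Suc r\<close>; registers 0 and 1 survive, so both codes see the same arguments.\<close>

lemma expressible_binary:
  assumes "expressible f" "expressible g"
    and op: "\<And>r a b. sequential (op r a b)" "\<And>r a b. silent (op r a b)"
      "\<And>m r a b R. exec_reg m (op r a b) R = R(r := h (R a) (R b))"
  shows "expressible (\<lambda>m p l. h (f m p l) (g m p l))"
  unfolding expressible_def
proof (intro allI impI)
  fix r :: nat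
  assume r: "2 \<le> r"
  with assms(1) obtain cf where cf: "\<forall>c\<in>set cf. sequential c \<and> silent c"
    "\<forall>m R. fold (exec_reg m) cf R r = f m (R 0) (R 1) \<and> (\<forall>s<r. fold (exec_reg m) cf R s = R s)"
    unfolding expressible_def by blast
  from r have "2 \<le> Suc r"
    by simp
  with assms(2) obtain cg where cg: "\<forall>c\<in>set cg. sequential c \<and> silent c"
    "\<forall>m R. fold (exec_reg m) cg R (Suc r) = g m (R 0) (R 1) \<and>
           (\<forall>s<Suc r. fold (exec_reg m) cg R s = R s)"
    unfolding expressible_def by blast
  show "\<exists>code. (\<forall>c\<in>set code. sequential c \<and> silent c) \<and>
     (\<forall>m R. fold (exec_reg m) code R r = h (f m (R 0) (R 1)) (g m (R 0) (R 1)) \<and>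
            (\<forall>s<r. fold (exec_reg m) code R s = R s))"
    using r cf cg by (intro exI[of _ "cf @ cg @ [op r r (Suc r)]"]) (auto simp: op)
qed

lemma expressible_add:
  "expressible f \<Longrightarrow> expressible g \<Longrightarrow> expressible (\<lambda>m p l. f m p l + g m p l)"
  by (rule expressible_binary[where op = Add]) auto

lemma expressible_sub:
  "expressible f \<Longrightarrow> expressible g \<Longrightarrow> expressible (\<lambda>m p l. f m p l - g m p l)"
  by (rule expressible_binary[where op = Sub]) auto

lemma expressible_div:
  "expressible f \<Longrightarrow> expressible g \<Longrightarrow> expressible (\<lambda>m p l. f m p l div g m p l)"
  by (rule expressible_binary[where op = Div]) auto

lemma expressible_mod:
  "expressible f \<Longrightarrow> expressible g \<Longrightarrow> expressible (\<lambda>m p l. f m p l mod g m p l)"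
  by (rule expressible_binary[where op = Mod]) auto

lemma expressible_times_const:
  assumes "expressible f"
  shows "expressible (\<lambda>m p l. k * f m p l)"
proof (induction k)
  case 0
  show ?case
    using expressible_const[of 0] by simp
next
  case (Suc k)
  show ?case
    using expressible_add[OF assms Suc] by simp
qed

lemma expressible_pred_le:
  assumes "expressible f" "expressible g"
  shows "expressible_pred (\<lambda>m p l. f m p l \<le> g m p l)"
proof -
  \<comment> \<open>Subtraction is truncated, so the inner difference is 0 exactly if the comparison
    holds.\<close>
  have "(\<lambda>m p l. of_bool (f m p l \<le> g m p l)) = (\<lambda>m p l. 1 - (f m p l - g m p l))"
    by (intro ext) auto
  then show ?thesis
    unfolding expressible_pred_def using assms by (simp only:) (intro expressible_sub expressible_const)
qed

lemma expressible_pred_not: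
  assumes "expressible_pred Q"
  shows "expressible_pred (\<lambda>m p l. \<not> Q m p l)"
proof -
  have "(\<lambda>m p l. of_bool (\<not> Q m p l)) = (\<lambda>m p l. 1 - of_bool (Q m p l) :: nat)"
    by (intro ext) auto
  then show ?thesis
    using assms unfolding expressible_pred_def by (simp only:) (intro expressible_sub expressible_const)
qed

lemma expressible_pred_conj:
  assumes "expressible_pred Q" "expressible_pred Q'"
  shows "expressible_pred (\<lambda>m p l. Q m p l \<and> Q' m p l)"
proof -
  have "(\<lambda>m p l. of_bool (Q m p l \<and> Q' m p l)) =
        (\<lambda>m p l. of_bool (Q m p l) + of_bool (Q' m p l) - 1 :: nat)"
    by (intro ext) auto
  then show ?thesis
    using assms unfolding expressible_pred_def
    by (simp only:) (intro expressible_sub expressible_add expressible_const)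
qed

lemma expressible_pred_disj:
  assumes "expressible_pred Q" "expressible_pred Q'"
  shows "expressible_pred (\<lambda>m p l. Q m p l \<or> Q' m p l)"
proof -
  have "expressible_pred (\<lambda>m p l. \<not> (\<not> Q m p l \<and> \<not> Q' m p l))"
    using assms by (intro expressible_pred_not expressible_pred_conj)
  then show ?thesis
    by simp
qed

lemma expressible_pred_less:
  assumes "expressible f" "expressible g"
  shows "expressible_pred (\<lambda>m p l. f m p l < g m p l)"
  using expressible_pred_not[OF expressible_pred_le[OF assms(2,1)]] by (simp add: not_le)

lemma expressible_pred_eq:
  assumes "expressible f" "expressible g"
  shows "expressible_pred (\<lambda>m p l. f m p l = g m p l)"
  using expressible_pred_conj[OF expressible_pred_le[OF assms] expressible_pred_le[OF assms(2,1)]]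
  by (simp add: eq_iff[symmetric])

text \<open>There is no multiplication, but \<open>e * b = e mod (e + b)\<close> for \<open>b \<in> {0, 1}\<close>.\<close>

lemma expressible_if:
  assumes "expressible_pred Q" "expressible f" "expressible g"
  shows "expressible (\<lambda>m p l. if Q m p l then f m p l else g m p l)"
proof -
  have "(\<lambda>m p l. if Q m p l then f m p l else g m p l) =
        (\<lambda>m p l. f m p l mod (f m p l + of_bool (Q m p l)) +
                 g m p l mod (g m p l + of_bool (\<not> Q m p l)))"
    by (intro ext) auto
  then show ?thesis
    using assms expressible_pred_not[OF assms(1)] unfolding expressible_pred_def
    by (simp only:) (intro expressible_mod expressible_add)
qed

lemmas expressible_intros =
  expressible_const expressible_proc expressible_length expressible_add expressible_sub
  expressible_div expressible_mod expressible_times_const expressible_if expressible_load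
  expressible_pred_le expressible_pred_not expressible_pred_conj expressible_pred_disj
  expressible_pred_less expressible_pred_eq

text \<open>
  All programs considered here are free of jumps, so that the processors run in lockstep. The arguments of
  a memory transformation are the number of processors, the input length and the memory.
\<close>

definition ready :: "nat \<Rightarrow> nat \<Rightarrow> nat \<Rightarrow> pram_state \<Rightarrow> bool" where
  "ready P l i s \<longleftrightarrow> (\<forall>p<P. pc s p = i \<and> reg s p 0 = p \<and> reg s p 1 = l)"

text \<open>The arbitrary \<open>pre\<close> and \<open>post\<close> make the notion compositional:
  a piece of code may stand anywhere in a program.\<close>

definition implements :: "program \<Rightarrow> (nat \<Rightarrow> nat \<Rightarrow> (nat \<Rightarrow> nat) \<Rightarrow> (nat \<Rightarrow> nat)) \<Rightarrow> bool" where
  "implements code F \<longleftrightarrow> (\<forall>pre post P l s. ready P l (length pre) s \<longrightarrow>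
     (let s' = (pram_step (pre @ code @ post) P ^^ length code) s
      in ready P l (length pre + length code) s' \<and> mem s' = F P l (mem s)))"

definition straight_line :: "(nat \<Rightarrow> nat \<Rightarrow> (nat \<Rightarrow> nat) \<Rightarrow> (nat \<Rightarrow> nat)) \<Rightarrow> bool" where
  "straight_line F \<longleftrightarrow> (\<exists>code. implements code F)"

lemma implements_append:
  assumes "implements c1 F1" "implements c2 F2"
  shows "implements (c1 @ c2) (\<lambda>P l m. F2 P l (F1 P l m))"
  unfolding implements_def Let_def
proof (intro allI impI)
  fix pre post :: program and P l s
  assume s: "ready P l (length pre) s"
  let ?step = "pram_step (pre @ (c1 @ c2) @ post) P"
  define s1 where "s1 = (?step ^^ length c1) s"
  define s2 where "s2 = (?step ^^ length c2) s1"
  have 1: "ready P l (length (pre @ c1)) s1" "mem s1 = F1 P l (mem s)"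
    using assms(1)[unfolded implements_def Let_def, rule_format, OF s, of "c2 @ post"]
    by (simp_all add: s1_def)
  have 2: "ready P l (length (pre @ c1) + length c2) s2" "mem s2 = F2 P l (mem s1)"
    using assms(2)[unfolded implements_def Let_def, rule_format, OF 1(1), of post]
    by (simp_all add: s2_def)
  have "(?step ^^ length (c1 @ c2)) s = s2"
    by (simp add: s1_def s2_def funpow_add add.commute[of "length c1"])
  then show "ready P l (length pre + length (c1 @ c2)) ((?step ^^ length (c1 @ c2)) s) \<and>
    mem ((?step ^^ length (c1 @ c2)) s) = F2 P l (F1 P l (mem s))"
    using 1 2 by (simp add: add.assoc)
qed

lemma straight_line_comp:
  "straight_line F1 \<Longrightarrow> straight_line F2 \<Longrightarrow> straight_line (\<lambda>P l m. F2 P l (F1 P l m))"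
  unfolding straight_line_def using implements_append by blast

lemma pram_step_sequential:
  assumes "\<forall>p<P. pc s p = i" "i < length prog" "sequential (prog ! i)" "p < P"
  shows "pc (pram_step prog P s) p = Suc i"
    "reg (pram_step prog P s) p = exec_reg (mem s) (prog ! i) (reg s p)"
  using assms by (auto simp: pram_step_def active_def sequential_def)

text \<open>Without writes every load sees the initial memory, so each processor just folds the code
  over its own registers.\<close>

lemma pram_run_silent:
  assumes "\<forall>c\<in>set code. sequential c \<and> silent c" "\<forall>p<P. pc s p = length pre"
  shows "let s' = (pram_step (pre @ code @ post) P ^^ length code) s
    in (\<forall>p<P. pc s' p = length pre + length code \<and>
              reg s' p = fold (exec_reg (mem s)) code (reg s p)) \<and> mem s' = mem s"
  using assms
proof (induction code arbitrary: pre s)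
  case Nil
  then show ?case by simp
next
  case (Cons c code)
  let ?prog = "pre @ (c # code) @ post"
  let ?s = "pram_step ?prog P s"
  have c: "?prog ! length pre = c" "length pre < length ?prog"
    by simp_all
  have step: "\<forall>p<P. pc ?s p = Suc (length pre) \<and> reg ?s p = exec_reg (mem s) c (reg s p)"
    using pram_step_sequential[OF Cons.prems(2) c(2)] Cons.prems(1) c(1) by simp
  have "write_request ?prog P s p = None" for p
    using Cons.prems c by (auto simp: write_request_def active_def silent_def)
  then have mem: "mem ?s = mem s"
    by (simp add: pram_step_def)
  have "\<forall>p<P. pc ?s p = length (pre @ [c])"
    using step by simp
  from Cons.IH[OF _ this] Cons.prems(1) step mem show ?case
    by (auto simp: Let_def funpow_swap1[symmetric] simp del: funpow.simps)
       (simp_all add: funpow_swap1)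
qed

text \<open>Addresses and values are all computed from the old memory; \<open>LEAST\<close> reflects
  the priority rule for conflicting writes.\<close>

definition par_write ::
    "((nat \<Rightarrow> nat) \<Rightarrow> nat \<Rightarrow> nat \<Rightarrow> nat) \<Rightarrow> ((nat \<Rightarrow> nat) \<Rightarrow> nat \<Rightarrow> nat \<Rightarrow> nat) \<Rightarrow>
     nat \<Rightarrow> nat \<Rightarrow> (nat \<Rightarrow> nat) \<Rightarrow> (nat \<Rightarrow> nat)" where
  "par_write A V P l m =
     (\<lambda>a. if \<exists>p<P. A m p l = a then V m (LEAST p. p < P \<and> A m p l = a) l else m a)"

lemma straight_line_par_write:
  assumes "expressible A" "expressible V"
  shows "straight_line (par_write A V)"
proof -
  obtain ca where ca: "\<forall>c\<in>set ca. sequential c \<and> silent c"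
    "\<And>m R. fold (exec_reg m) ca R 2 = A m (R 0) (R 1)"
    "\<And>m R s. s < 2 \<Longrightarrow> fold (exec_reg m) ca R s = R s"
    using assms(1) unfolding expressible_def by (metis order_refl)
  \<comment> \<open>The value is compiled for register 3 so that the address in register 2
    survives.\<close>
  have "(2::nat) \<le> 3"
    by simp
  then obtain cv where cv: "\<forall>c\<in>set cv. sequential c \<and> silent c"
    "\<And>m R. fold (exec_reg m) cv R 3 = V m (R 0) (R 1)"
    "\<And>m R s. s < 3 \<Longrightarrow> fold (exec_reg m) cv R s = R s"
    using assms(2) unfolding expressible_def by metis
  define code where "code = ca @ cv"
  have code: "\<forall>c\<in>set code. sequential c \<and> silent c"
    using ca(1) cv(1) by (auto simp: code_def)
  have regs: "fold (exec_reg m) code R 0 = R 0" "fold (exec_reg m) code R 1 = R 1"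
    "fold (exec_reg m) code R 2 = A m (R 0) (R 1)" "fold (exec_reg m) code R 3 = V m (R 0) (R 1)"
    for m R
    by (simp_all add: code_def ca cv)
  have "implements (code @ [Store 2 3]) (par_write A V)"
    unfolding implements_def Let_def
  proof (intro allI impI)
    fix pre post :: program and P l s
    assume s: "ready P l (length pre) s"
    define prog where "prog = pre @ (code @ [Store 2 3]) @ post"
    define i where "i = length pre + length code"
    define s1 where "s1 = (pram_step prog P ^^ length code) s"
    have pc_s: "\<forall>p<P. pc s p = length pre"
      using s by (simp add: ready_def)
    have s1: "\<forall>p<P. pc s1 p = i \<and> reg s1 p = fold (exec_reg (mem s)) code (reg s p)"
      "mem s1 = mem s"
      using pram_run_silent[OF code pc_s, of "Store 2 3 # post"]
      by (simp_all add: s1_def Let_def prog_def i_def)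
    have i_eq: "prog ! i = Store 2 3" "i < length prog"
      by (simp_all add: nth_append prog_def i_def)
    define s2 where "s2 = pram_step prog P s1"
    have "\<forall>p<P. pc s2 p = Suc i \<and> reg s2 p = reg s1 p"
      using pram_step_sequential[OF _ i_eq(2), of P s1] s1(1) i_eq(1) by (simp add: s2_def)
    then have ready: "ready P l (Suc i) s2"
      using s s1(1) by (simp add: ready_def regs[unfolded One_nat_def])
    have wr: "write_request prog P s1 p =
        (if p < P then Some (A (mem s) p l, V (mem s) p l) else None)" for p
      using s s1(1) i_eq by (simp add: write_request_def active_def ready_def regs[unfolded One_nat_def])
    have "mem s2 = par_write A V P l (mem s)"
    proof
      fix a
      let ?p = "LEAST p. p < P \<and> A (mem s) p l = a"
      have iff: "(\<exists>v. write_request prog P s1 p = Some (a, v)) \<longleftrightarrow> p < P \<and> A (mem s) p l = a"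
        for p
        by (simp add: wr)
      have "?p < P" if "\<exists>p<P. A (mem s) p l = a"
        using LeastI_ex[of "\<lambda>p. p < P \<and> A (mem s) p l = a"] that by auto
      then show "mem s2 a = par_write A V P l (mem s) a"
        by (simp add: s2_def pram_step_def par_write_def iff s1(2)) (auto simp: wr)
    qed
    with ready show "ready P l (length pre + length (code @ [Store 2 3]))
        ((pram_step (pre @ (code @ [Store 2 3]) @ post) P ^^ length (code @ [Store 2 3])) s) \<and>
      mem ((pram_step (pre @ (code @ [Store 2 3]) @ post) P ^^ length (code @ [Store 2 3])) s) = par_write A V P l (mem s)"
      unfolding prog_def[symmetric] by (simp add: s1_def s2_def i_def)
  qed
  then show ?thesis
    unfolding straight_line_def by blast
qed

text \<open>A single concurrent write decides an existential statement about processors and selects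
  its least witness. The address \<open>l + k\<close> lies behind the input, which stays
  intact.\<close>

definition write_first ::
    "nat \<Rightarrow> ((nat \<Rightarrow> nat) \<Rightarrow> nat \<Rightarrow> nat \<Rightarrow> bool) \<Rightarrow> ((nat \<Rightarrow> nat) \<Rightarrow> nat \<Rightarrow> nat \<Rightarrow> nat) \<Rightarrow>
     nat \<Rightarrow> nat \<Rightarrow> (nat \<Rightarrow> nat) \<Rightarrow> (nat \<Rightarrow> nat)" where
  "write_first k Q V P l m =
     (if \<exists>p<P. Q m p l then m(l + k := V m (LEAST p. p < P \<and> Q m p l) l) else m)"

text \<open>The processors that are not to write anything replace the contents of address 0 by itself.\<close>

lemma straight_line_write_first:
  assumes "expressible_pred Q" "expressible V" "0 < k"
  shows "straight_line (write_first k Q V)"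
proof -
  let ?A = "\<lambda>m p l. if Q m p l then l + k else 0"
  let ?V = "\<lambda>m p l. if Q m p l then V m p l else m 0"
  have "straight_line (par_write ?A ?V)"
    using assms by (intro straight_line_par_write expressible_intros)
  moreover have "par_write ?A ?V P l m a = write_first k Q V P l m a" for P l m a
  proof -
    consider "a = l + k" | "a = 0" | "a \<noteq> l + k" "a \<noteq> 0"
      by blast
    then show ?thesis
    proof cases
      case 1
      then have *: "?A m p l = a \<longleftrightarrow> Q m p l" for p
        using \<open>0 < k\<close> by auto
      have "Q m (LEAST p. p < P \<and> Q m p l) l" if "\<exists>p<P. Q m p l"
        using LeastI_ex[of "\<lambda>p. p < P \<and> Q m p l"] that by auto
      then show ?thesis
        unfolding par_write_def * unfolding write_first_def 1 by auto
    next
      case 2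
      then have *: "?A m p l = a \<longleftrightarrow> \<not> Q m p l" for p
        using \<open>0 < k\<close> by auto
      have "\<not> Q m (LEAST p. p < P \<and> \<not> Q m p l) l" if "\<exists>p<P. \<not> Q m p l"
        using LeastI_ex[of "\<lambda>p. p < P \<and> \<not> Q m p l"] that by auto
      then show ?thesis
        using \<open>0 < k\<close> unfolding par_write_def * unfolding write_first_def 2 by simp
    next
      case 3
      then show ?thesis
        by (auto simp: par_write_def write_first_def)
    qed
  qed
  then have "par_write ?A ?V = write_first k Q V"
    by (intro ext)
  ultimately show ?thesis
    by simp
qed

text \<open>The running time is the constant \<open>length code\<close>. In \<open>NC\<close> one
  \<open>k\<close> serves both as the exponent of the processor bound and as the power of the
  logarithm; this is harmless, as the logarithm is eventually at least 1.\<close>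

lemma straight_line_imp_NC:
  assumes "straight_line F" "0 < k"
    and "\<And>w. F ((length w + 1) ^ k) (length w) (mem (pram_init w)) 0 = 1 \<longleftrightarrow> w \<in> L"
  shows "L \<in> NC"
proof -
  obtain code where code: "implements code F"
    using assms(1) unfolding straight_line_def by blast
  have "(\<lambda>n. real (length code)) \<in> O(\<lambda>n::nat. ln (real n) ^ k)"
  proof (rule landau_o.big_trans)
    show "(\<lambda>n. real (length code)) \<in> O(\<lambda>n::nat. 1)"
      by simp
    have "eventually (\<lambda>n::nat. 1 \<le> ln (real n)) sequentially"
      using filterlim_compose[OF ln_at_top filterlim_real_sequentially]
      by (simp add: filterlim_at_top)
    then have "eventually (\<lambda>n::nat. 1 \<le> \<bar>ln (real n) ^ k\<bar>) sequentially"
      by eventually_elim (simp add: one_le_power order.trans[OF _ abs_ge_self])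
    then show "(\<lambda>n::nat. 1) \<in> O(\<lambda>n. ln (real n) ^ k)"
      by (intro bigoI[of _ 1]) simp
  qed
  moreover have "pram_decides code (\<lambda>n. (n + 1) ^ k) (\<lambda>_. length code) L"
    unfolding pram_decides_def
  proof (intro allI exI[of _ "length code"] conjI)
    fix w :: "bool list"
    let ?P = "(length w + 1) ^ k"
    have "ready ?P (length w) (length ([] :: program)) (pram_init w)"
      by (simp add: ready_def pram_init_def)
    from code[unfolded implements_def Let_def, rule_format, OF this, of "[]"]
    show "let s = pram_run code ?P w (length code)
      in (\<forall>p. \<not> active code ?P s p) \<and> (mem s 0 = 1 \<longleftrightarrow> w \<in> L)"
      using assms(3)[of w] by (auto simp: Let_def pram_run_def ready_def active_def)
  qed simp
  ultimately show ?thesis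
    unfolding NC_def
    by (intro CollectI exI[of _ code] exI[of _ k] exI[of _ "\<lambda>_. length code"] conjI)
qed

section \<open>Instances of the stability problem\<close>

text \<open>Nested enumeration becomes division with remainder; this yields the cell at a given
  position of \<open>region n\<close>.\<close>

lemma concat_map_upt:
  "concat (map (\<lambda>i. map (f i) [0..<k]) [0..<n]) = map (\<lambda>q. f (q div k) (q mod k)) [0..<n * k]"
proof (induction n)
  case (Suc n)
  have "[0..<n * k + k] = [0..<n * k] @ [n * k..<n * k + k]"
    by (rule upt_add_eq_append) simp
  then have "[0..<Suc n * k] = [0..<n * k] @ map (\<lambda>r. r + n * k) [0..<k]"
    by (simp add: map_add_upt add.commute)
  with Suc show ?case
    by simp
qed simp

definition cell_of :: "nat \<Rightarrow> int \<Rightarrow> int \<Rightarrow> cell" where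
  "cell_of q i j = (if q mod 2 = 0 then Up i j else Down i j)"

text \<open>The position is \<open>q = 2 * n * i + 2 * j + t\<close>, with \<open>t = 0\<close> for
  up and \<open>t = 1\<close> for down; \<open>q\<close> has the parity of \<open>t\<close>.\<close>

definition cell_at :: "nat \<Rightarrow> nat \<Rightarrow> cell" where
  "cell_at n q = cell_of q (int (q div (2 * n))) (int (q mod (2 * n) div 2))"

lemma cell_of_simps [simp]:
  "cell_x (cell_of q i j) = i" "cell_y (cell_of q i j) = j"
  "cell_z (cell_of q i j) = - i - j - int (q mod 2)"
  by (auto simp: cell_of_def)

lemma cell_cases_cell_of: "\<exists>t<2. u = cell_of t (cell_x u) (cell_y u)"
proof (cases u)
  case (Up i j)
  then show ?thesis
    by (intro exI[of _ 0]) (simp add: cell_of_def)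
next
  case (Down i j)
  then show ?thesis
    by (intro exI[of _ 1]) (simp add: cell_of_def)
qed

lemma cell_of_eq_iff: "cell_of q i j = cell_of q' i' j' \<longleftrightarrow> q mod 2 = q' mod 2 \<and> i = i' \<and> j = j'"
  by (auto simp: cell_of_def)

lemma region_eq: "region n = map (cell_at n) [0..<2 * n * n]"
proof -
  have upto: "[0..int n - 1] = map int [0..<n]"
    by (induction n) (simp_all add: upto_rec2)
  have two: "[Up i j, Down i j] = map (\<lambda>t. cell_of t i j) [0..<2]" for i j
    by (simp add: cell_of_def upt_rec)
  have "region n = concat (map (\<lambda>i. concat (map (\<lambda>j. map (\<lambda>t. cell_of t (int i) (int j)) [0..<2])
      [0..<n])) [0..<n])"
    by (simp add: region_def upto two comp_def)
  also have "\<dots> = map (\<lambda>q. cell_of (q mod (n * 2) mod 2) (int (q div (n * 2)))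
      (int (q mod (n * 2) div 2))) [0..<n * (n * 2)]"
    by (simp add: concat_map_upt)
  also have "\<dots> = map (cell_at n) [0..<2 * n * n]"
    by (simp add: cell_at_def cell_of_def mod_mod_cancel mult_ac)
  finally show ?thesis .
qed

lemma inj_cell_at: "inj (cell_at n)"
proof (rule injI)
  fix q q'
  assume "cell_at n q = cell_at n q'"
  then have eq: "q mod 2 = q' mod 2" "q div (2 * n) = q' div (2 * n)"
    "q mod (2 * n) div 2 = q' mod (2 * n) div 2"
    by (auto simp: cell_at_def cell_of_eq_iff)
  moreover have "q mod (2 * n) mod 2 = q mod 2" for q
    by (simp add: mod_mod_cancel)
  ultimately have "q mod (2 * n) = q' mod (2 * n)"
    by (metis div_mult_mod_eq)
  with eq(2) show "q = q'"
    by (metis div_mult_mod_eq)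
qed

lemma cell_at_less:
  fixes n q :: nat
  assumes "q < 2 * n * n"
  shows "q div (2 * n) < n" "q mod (2 * n) div 2 < n"
proof -
  have "0 < n"
    using assms by (cases n) auto
  then show "q div (2 * n) < n" "q mod (2 * n) div 2 < n"
    using assms by (auto simp: less_mult_imp_div_less mult_ac)
qed

text \<open>The configuration is read off the word alone, because the \<open>x\<close> behind an
  encoding is determined only on the region.\<close>

definition word_config :: "nat \<Rightarrow> bool list \<Rightarrow> configuration" where
  "word_config n w = periodic n (\<lambda>v. \<exists>q<2 * n * n. v = cell_at n q \<and> w ! (n + 1 + q))"

lemma word_config_cell_of:
  "word_config n w (cell_of t i j) \<longleftrightarrow>
     (\<exists>q<2 * n * n. w ! (n + 1 + q) \<and> q mod 2 = t mod 2 \<and>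
        int (q div (2 * n)) = i mod int n \<and> int (q mod (2 * n) div 2) = j mod int n)"
proof -
  have "periodic n x (cell_of t i j) = x (cell_of t (i mod int n) (j mod int n))" for x
    by (simp add: cell_of_def)
  then show ?thesis
    unfolding word_config_def cell_at_def by (auto simp: cell_of_eq_iff)
qed

lemma periodic_cong:
  assumes "0 < n" "\<And>v. v \<in> set (region n) \<Longrightarrow> x v = x' v"
  shows "periodic n x = periodic n x'"
proof
  fix u
  have "Up i j \<in> set (region n) \<and> Down i j \<in> set (region n)"
    if "0 \<le> i" "i < int n" "0 \<le> j" "j < int n" for i j
    using that unfolding region_def by auto
  with assms show "periodic n x u = periodic n x' u"
    by (cases u) simp_all
qed

lemma all_less_add:
  "(\<forall>i<a + b. Q i) \<longleftrightarrow> (\<forall>i<a. Q i) \<and> (\<forall>i<b. Q (a + i))" for a b :: nat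
  by (metis add_less_cancel_left le_Suc_ex not_less trans_less_add1)

lemma encode_eq_iff:
  "w = encode n x u \<longleftrightarrow> length w = 4 * n * n + n + 1 \<and> (\<forall>i<n. w ! i) \<and> \<not> w ! n \<and>
     (\<forall>q<2 * n * n. w ! (n + 1 + q) = x (cell_at n q)) \<and>
     (\<forall>q<2 * n * n. w ! (n + 1 + 2 * n * n + q) = (cell_at n q = u))"
proof -
  define M where "M = 2 * n * n"
  have enc: "encode n x u = replicate n True @ [False] @ map (\<lambda>q. x (cell_at n q)) [0..<M] @
      map (\<lambda>q. cell_at n q = u) [0..<M]"
    by (simp add: encode_def region_eq M_def)
  have "w = encode n x u \<longleftrightarrow> length w = n + (1 + (M + M)) \<and>
      (\<forall>i<n + (1 + (M + M)). w ! i = encode n x u ! i)"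
    unfolding list_eq_iff_nth_eq by (auto simp: enc)
  also have "\<dots> \<longleftrightarrow> length w = n + (1 + (M + M)) \<and> (\<forall>i<n. w ! i) \<and> \<not> w ! n \<and>
     (\<forall>q<M. w ! (n + 1 + q) = x (cell_at n q)) \<and>
     (\<forall>q<M. w ! (n + 1 + M + q) = (cell_at n q = u))"
    unfolding all_less_add by (simp add: enc nth_append add.assoc)
  finally show ?thesis
    by (simp add: M_def mult.assoc add.commute)
qed

text \<open>The quantifiers over \<open>x\<close> and \<open>u\<close> are replaced by conditions on
  single bits and a position \<open>k\<close>; injectivity of \<open>cell_at\<close> turns the
  marking bits into the test \<open>q = k\<close>.\<close>

lemma STABILITY_iff:
  "w \<in> STABILITY I \<longleftrightarrow> (\<exists>n k. 0 < n \<and> length w = 4 * n * n + n + 1 \<and> (\<forall>i<n. w ! i) \<and> \<not> w ! n \<and>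
     k < 2 * n * n \<and> (\<forall>q<2 * n * n. w ! (n + 1 + 2 * n * n + q) = (q = k)) \<and>
     \<not> w ! (n + 1 + k) \<and> stable I (word_config n w) (cell_at n k))"
proof
  assume "w \<in> STABILITY I"
  then obtain n x u where nxu: "w = encode n x u" "u \<in> set (region n)" "\<not> x u"
    "stable I (periodic n x) u"
    by (auto simp: STABILITY_def)
  then obtain k where k: "k < 2 * n * n" "u = cell_at n k"
    by (auto simp: region_eq)
  note w = nxu(1)[unfolded encode_eq_iff]
  have eq_u: "cell_at n q = u \<longleftrightarrow> q = k" for q
    by (simp add: k(2) inj_eq[OF inj_cell_at])
  have n: "0 < n"
    using k(1) by (cases n) auto
  have "periodic n x = word_config n w"
    unfolding word_config_def
  proof (rule periodic_cong[OF n])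
    fix v
    assume "v \<in> set (region n)"
    then obtain q where "q < 2 * n * n" "v = cell_at n q"
      by (auto simp: region_eq)
    then show "x v = (\<exists>q<2 * n * n. v = cell_at n q \<and> w ! (n + 1 + q))"
      using w inj_cell_at[of n] by (auto dest: injD)
  qed
  then show "\<exists>n k. 0 < n \<and> length w = 4 * n * n + n + 1 \<and> (\<forall>i<n. w ! i) \<and> \<not> w ! n \<and>
     k < 2 * n * n \<and> (\<forall>q<2 * n * n. w ! (n + 1 + 2 * n * n + q) = (q = k)) \<and>
     \<not> w ! (n + 1 + k) \<and> stable I (word_config n w) (cell_at n k)"
    using w[unfolded eq_u] n k nxu(3,4) by metis
next
  assume "\<exists>n k. 0 < n \<and> length w = 4 * n * n + n + 1 \<and> (\<forall>i<n. w ! i) \<and> \<not> w ! n \<and>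
     k < 2 * n * n \<and> (\<forall>q<2 * n * n. w ! (n + 1 + 2 * n * n + q) = (q = k)) \<and>
     \<not> w ! (n + 1 + k) \<and> stable I (word_config n w) (cell_at n k)"
  then obtain n k where nk: "0 < n" "length w = 4 * n * n + n + 1" "\<forall>i<n. w ! i" "\<not> w ! n"
     "k < 2 * n * n" "\<forall>q<2 * n * n. w ! (n + 1 + 2 * n * n + q) = (q = k)"
     "\<not> w ! (n + 1 + k)" "stable I (word_config n w) (cell_at n k)"
    by blast
  define x where "x v \<longleftrightarrow> (\<exists>q<2 * n * n. v = cell_at n q \<and> w ! (n + 1 + q))" for v
  have x: "x (cell_at n q) = w ! (n + 1 + q)" if "q < 2 * n * n" for q
    using that inj_cell_at[of n] by (auto simp: x_def dest: injD)
  have "w = encode n x (cell_at n k)"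
    unfolding encode_eq_iff inj_eq[OF inj_cell_at] using nk x by blast
  moreover have "word_config n w = periodic n x"
    by (simp add: word_config_def x_def[abs_def])
  ultimately show "w \<in> STABILITY I"
    unfolding STABILITY_def using nk(5,7,8) x[OF nk(5)]
    by (auto simp: region_eq intro!: exI[of _ n] exI[of _ x] exI[of _ "cell_at n k"])
qed

text \<open>
  Active cells near the base period are given by natural numbers \<open>I\<close>, \<open>J\<close>, the coordinates
  shifted by \<open>4 n\<close>, and by the number \<open>q\<close> of a cell of the region that has the same state.
\<close>

definition active_cell :: "nat \<Rightarrow> bool list \<Rightarrow> nat \<Rightarrow> nat \<Rightarrow> nat \<Rightarrow> bool" where
  "active_cell n w I J q \<longleftrightarrow> q < 2 * n * n \<and> w ! (n + 1 + q) \<and>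
     I mod n = q div (2 * n) \<and> J mod n = q mod (2 * n) div 2"

definition shifted_cell :: "nat \<Rightarrow> nat \<Rightarrow> nat \<Rightarrow> nat \<Rightarrow> cell" where
  "shifted_cell n I J q = cell_of q (int I - int (4 * n)) (int J - int (4 * n))"

text \<open>The shift \<open>4 * n\<close> is a multiple of the period, so it removes negative
  coordinates without changing residues.\<close>

lemma mod_shift: "(int I - int (4 * n)) mod int n = int (I mod n)"
proof -
  have "(int I - int (4 * n)) mod int n = int I mod int n"
    using mod_mult_self1[of "int I" "-4" "int n"] by simp
  then show ?thesis
    by (simp add: zmod_int)
qed

lemma active_cell_word_config:
  "active_cell n w I J q \<Longrightarrow> word_config n w (shifted_cell n I J q)"
  unfolding shifted_cell_def word_config_cell_of mod_shift active_cell_def by auto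

text \<open>The first two coordinates of \<open>cell_at n k\<close> lie in \<open>[0, n)\<close> and
  those of \<open>a\<close> differ from them by at most \<open>4 n\<close>; shifted by
  \<open>4 n\<close> they lie in \<open>[0, 9 n)\<close>.\<close>

lemma active_within_cases:
  assumes "word_config n w a" "k < 2 * n * n" "cell_dist (cell_at n k) a \<le> 4 * n"
  obtains I J q where "active_cell n w I J q" "a = shifted_cell n I J q" "I < 9 * n" "J < 9 * n"
proof -
  let ?u = "cell_at n k"
  have ux: "cell_x ?u \<ge> 0" "cell_x ?u < int n" "cell_y ?u \<ge> 0" "cell_y ?u < int n"
    using cell_at_less[OF assms(2)] unfolding cell_at_def by (simp_all add: nat_less_iff[symmetric])
  have "\<bar>cell_x ?u - cell_x a\<bar> \<le> 4 * int n" "\<bar>cell_y ?u - cell_y a\<bar> \<le> 4 * int n"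
    using int_cell_dist[of ?u a] assms(3) by linarith+
  then have bounds: "0 \<le> cell_x a + 4 * int n" "cell_x a + 4 * int n < 9 * int n"
    "0 \<le> cell_y a + 4 * int n" "cell_y a + 4 * int n < 9 * int n"
    using ux by linarith+
  define I J where "I = nat (cell_x a + 4 * int n)" and "J = nat (cell_y a + 4 * int n)"
  have IJ: "cell_x a = int I - int (4 * n)" "cell_y a = int J - int (4 * n)"
    using bounds by (simp_all add: I_def J_def)
  obtain t where t: "t < 2" "a = cell_of t (cell_x a) (cell_y a)"
    using cell_cases_cell_of by blast
  with assms(1) obtain q where q: "q < 2 * n * n" "w ! (n + 1 + q)" "q mod 2 = t mod 2"
    "int (q div (2 * n)) = int (I mod n)" "int (q mod (2 * n) div 2) = int (J mod n)"
    unfolding word_config_cell_of IJ mod_shift by (metis word_config_cell_of mod_shift)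
  have "active_cell n w I J q"
    using q unfolding active_cell_def by simp
  moreover have "a = shifted_cell n I J q"
    using t(2) q(3) unfolding IJ shifted_cell_def by (metis cell_of_eq_iff)
  moreover have "I < 9 * n" "J < 9 * n"
    using bounds by (simp_all add: I_def J_def)
  ultimately show ?thesis
    using that by blast
qed

text \<open>Both cells lie in the base region, where the first two coordinates differ by at most
  \<open>n - 1\<close> each and the third by at most \<open>2 n - 1\<close>. This is the origin of
  the bound \<open>4 n\<close>.\<close>

lemma active_near_cell_at:
  assumes "q < 2 * n * n" "w ! (n + 1 + q)" "k < 2 * n * n"
  shows "near (word_config n w) (4 * n) (cell_at n k)"
proof -
  have "word_config n w (cell_at n q)"
    unfolding cell_at_def word_config_cell_of using assms cell_at_less[OF assms(1)]
    by (intro exI[of _ q]) (simp add: zmod_int[symmetric])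
  moreover have "cell_dist (cell_at n k) (cell_at n q) \<le> 4 * n"
  proof -
    have bound: "\<bar>int a - int c\<bar> + \<bar>int b - int d\<bar> +
        \<bar>- int a - int b - int s - (- int c - int d - int t)\<bar> \<le> int (4 * n)"
      if "a < n" "b < n" "c < n" "d < n" "s < 2" "t < 2" for a b c d s t :: nat
      using that by linarith
    have "int (cell_dist (cell_at n k) (cell_at n q)) \<le> int (4 * n)"
      unfolding int_cell_dist cell_at_def cell_of_simps
      by (rule bound) (use assms cell_at_less in simp_all)
    then show ?thesis
      by (rule zle_int[THEN iffD1])
  qed
  ultimately show ?thesis
    unfolding near_def by blast
qed

section \<open>The decision procedure\<close>

definition gap :: "nat \<Rightarrow> nat \<Rightarrow> nat" where
  "gap a b = (a - b) + (b - a)"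

text \<open>This is \<open>toward\<close> for natural numbers. The third coordinate is represented
  with the opposite sign, so its arguments are exchanged.\<close>

definition side :: "nat \<Rightarrow> nat \<Rightarrow> nat \<Rightarrow> bool" where
  "side k a b \<longleftrightarrow> k mod 2 = 0 \<and> a < b \<or> k mod 2 = 1 \<and> b < a"

lemma int_gap: "int (gap a b) = \<bar>int a - int b\<bar>"
  by (auto simp: gap_def)

lemma cell_dist_shifted_cell:
  "cell_dist (shifted_cell n X Y k) (shifted_cell n I J q) =
     gap X I + gap Y J + gap (X + Y + k mod 2) (I + J + q mod 2)"
proof -
  have "int (cell_dist (shifted_cell n X Y k) (shifted_cell n I J q)) =
     int (gap X I + gap Y J + gap (X + Y + k mod 2) (I + J + q mod 2))"
    unfolding int_cell_dist shifted_cell_def cell_of_simps of_nat_add int_gap by simp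
  then show ?thesis
    by (rule of_nat_eq_iff[THEN iffD1])
qed

lemma toward_cell_of:
  "toward f (cell_of k i j) a \<longleftrightarrow>
     k mod 2 = 0 \<and> f a < f (cell_of k i j) \<or> k mod 2 = 1 \<and> f (cell_of k i j) < f a"
  by (auto simp: cell_of_def)

lemma toward_shifted_cell:
  "toward cell_x (shifted_cell n X Y k) (shifted_cell n I J q) \<longleftrightarrow> side k I X"
  "toward cell_y (shifted_cell n X Y k) (shifted_cell n I J q) \<longleftrightarrow> side k J Y"
  "toward cell_z (shifted_cell n X Y k) (shifted_cell n I J q) \<longleftrightarrow>
     side k (X + Y + k mod 2) (I + J + q mod 2)"
proof -
  have z: "- (int I - c) - (int J - c) - int t < - (int X - c) - (int Y - c) - int s \<longleftrightarrow>
      X + Y + s < I + J + t" for I J t X Y s :: nat and c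
    by linarith
  show "toward cell_x (shifted_cell n X Y k) (shifted_cell n I J q) \<longleftrightarrow> side k I X"
    "toward cell_y (shifted_cell n X Y k) (shifted_cell n I J q) \<longleftrightarrow> side k J Y"
    "toward cell_z (shifted_cell n X Y k) (shifted_cell n I J q) \<longleftrightarrow>
       side k (X + Y + k mod 2) (I + J + q mod 2)"
    unfolding shifted_cell_def toward_cell_of cell_of_simps side_def z by simp_all
qed

lemma cell_at_eq_shifted_cell:
  "cell_at n k = shifted_cell n (k div (2 * n) + 4 * n) (k mod (2 * n) div 2 + 4 * n) k"
  by (simp add: cell_at_def shifted_cell_def)

text \<open>
  The program, with \<open>p\<close> the processor and \<open>l\<close> the input length. The addresses from \<open>l + 3\<close> on
  hold the dimension, the successor of the number \<open>k\<close> of the cell \<open>u\<close>, a flag for malformed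
  inputs, the successor of the distance of \<open>u\<close> to the active cells, and three flags telling
  whether moving along the respective coordinate axis gets closer to them. A processor number is
  read as a quadruple of digits in base \<open>2 l\<close>; the guessed distance is the leading one, so that
  the write priority selects the least distance.
\<close>

type_synonym computation = "(nat \<Rightarrow> nat) \<Rightarrow> nat \<Rightarrow> nat \<Rightarrow> nat"

definition mem_dim :: computation where
  "mem_dim = (\<lambda>m p l. m (l + 3))"

text \<open>For \<open>l = 4 n^2 + n + 1\<close> this is \<open>2 n^2\<close>, obtained without
  multiplying.\<close>

definition mem_cells :: computation where
  "mem_cells = (\<lambda>m p l. (l - 1 - mem_dim m p l) div 2)"

definition mem_target :: computation where
  "mem_target = (\<lambda>m p l. m (l + 4) - 1)"

definition target_x :: computation where
  "target_x = (\<lambda>m p l. mem_target m p l div (2 * mem_dim m p l) + 4 * mem_dim m p l)"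

definition target_y :: computation where
  "target_y = (\<lambda>m p l. mem_target m p l mod (2 * mem_dim m p l) div 2 + 4 * mem_dim m p l)"

text \<open>The third coordinate is negated and offset by \<open>8 n\<close>, which keeps it a
  natural number.\<close>

definition target_z :: computation where
  "target_z = (\<lambda>m p l. target_x m p l + target_y m p l + mem_target m p l mod 2)"

definition guess_x :: computation where
  "guess_x = (\<lambda>m p l. p mod (2 * l))"

definition guess_y :: computation where
  "guess_y = (\<lambda>m p l. p div (2 * l) mod (2 * l))"

definition guess_cell :: computation where
  "guess_cell = (\<lambda>m p l. p div (2 * l) div (2 * l) mod (2 * l))"

definition guess_dist :: computation where
  "guess_dist = (\<lambda>m p l. p div (2 * l) div (2 * l) div (2 * l))"

definition guess_z :: computation where
  "guess_z = (\<lambda>m p l. guess_x m p l + guess_y m p l + guess_cell m p l mod 2)"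

definition guess_active :: "(nat \<Rightarrow> nat) \<Rightarrow> nat \<Rightarrow> nat \<Rightarrow> bool" where
  "guess_active = (\<lambda>m p l. guess_cell m p l < mem_cells m p l \<and>
     m (mem_dim m p l + 1 + guess_cell m p l) = 1 \<and>
     guess_x m p l mod mem_dim m p l = guess_cell m p l div (2 * mem_dim m p l) \<and>
     guess_y m p l mod mem_dim m p l = guess_cell m p l mod (2 * mem_dim m p l) div 2)"

definition actual_dist :: computation where
  "actual_dist = (\<lambda>m p l. gap (target_x m p l) (guess_x m p l) +
     gap (target_y m p l) (guess_y m p l) + gap (target_z m p l) (guess_z m p l))"

definition nearest :: "(nat \<Rightarrow> nat) \<Rightarrow> nat \<Rightarrow> nat \<Rightarrow> bool" where
  "nearest = (\<lambda>m p l. guess_active m p l \<and> actual_dist m p l + 1 = m (l + 6))"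

definition find_dim where
  "find_dim = write_first 3
     (\<lambda>m p l. 0 < p \<and> (l - 1) mod p = 0 \<and> (l - 1) div p = 4 * p + 1) (\<lambda>m p l. p)"

definition find_target where
  "find_target = write_first 4
     (\<lambda>m p l. p < mem_cells m p l \<and> m (mem_dim m p l + 1 + mem_cells m p l + p) = 1)
     (\<lambda>m p l. p + 1)"

text \<open>Every marked position other than the least one is a flaw, so an unflawed input has at
  most one mark; that there is one is visible from address \<open>l + 4\<close>.\<close>

definition find_flaw where
  "find_flaw = write_first 5
     (\<lambda>m p l. p < mem_dim m p l \<and> m p = 0 \<or> p = mem_dim m p l \<and> m p = 1 \<or>
        p < mem_cells m p l \<and> m (mem_dim m p l + 1 + mem_cells m p l + p) = 1 \<and>
        \<not> p = mem_target m p l)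
     (\<lambda>m p l. 1)"

definition find_dist where
  "find_dist = write_first 6
     (\<lambda>m p l. guess_active m p l \<and> actual_dist m p l = guess_dist m p l)
     (\<lambda>m p l. guess_dist m p l + 1)"

definition find_x where
  "find_x = write_first 7
     (\<lambda>m p l. nearest m p l \<and> side (mem_target m p l) (guess_x m p l) (target_x m p l))
     (\<lambda>m p l. 1)"

definition find_y where
  "find_y = write_first 8
     (\<lambda>m p l. nearest m p l \<and> side (mem_target m p l) (guess_y m p l) (target_y m p l))
     (\<lambda>m p l. 1)"

definition find_z where
  "find_z = write_first 9
     (\<lambda>m p l. nearest m p l \<and> side (mem_target m p l) (target_z m p l) (guess_z m p l))
     (\<lambda>m p l. 1)"

text \<open>For a well-formed input, 0 at address \<open>l + 6\<close> means that there are no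
  active cells, and then every cell is stable.\<close>

definition accepting :: "(nat \<Rightarrow> nat) \<Rightarrow> nat \<Rightarrow> nat \<Rightarrow> bool" where
  "accepting = (\<lambda>m p l. \<not> mem_dim m p l = 0 \<and> \<not> m (l + 4) = 0 \<and> m (l + 5) = 0 \<and>
     m (mem_dim m p l + 1 + mem_target m p l) = 0 \<and>
     (m (l + 6) = 0 \<or> m (l + 7) = 1 \<and> m (l + 8) = 1 \<and> m (l + 9) = 1))"

text \<open>Address 0 holds the first input bit, which is still needed before; it is overwritten
  last, and in both cases.\<close>

definition give_answer where
  "give_answer = par_write (\<lambda>m p l. 0) (\<lambda>m p l. if accepting m p l then 1 else 0)"

definition stability_program where
  "stability_program P l m = give_answer P l (find_z P l (find_y P l (find_x P l
     (find_dist P l (find_flaw P l (find_target P l (find_dim P l m)))))))"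

section \<open>Expressibility of the program\<close>

lemma expressible_gap:
  "expressible f \<Longrightarrow> expressible g \<Longrightarrow> expressible (\<lambda>m p l. gap (f m p l) (g m p l))"
  unfolding gap_def by (intro expressible_intros)

lemma expressible_pred_side:
  "expressible h \<Longrightarrow> expressible f \<Longrightarrow> expressible g \<Longrightarrow>
     expressible_pred (\<lambda>m p l. side (h m p l) (f m p l) (g m p l))"
  unfolding side_def by (intro expressible_intros)

lemma expressible_mem_dim: "expressible mem_dim"
  unfolding mem_dim_def by (intro expressible_intros)

lemma expressible_mem_cells: "expressible mem_cells"
  unfolding mem_cells_def by (intro expressible_intros expressible_mem_dim)

lemma expressible_mem_target: "expressible mem_target"
  unfolding mem_target_def by (intro expressible_intros)

lemma expressible_target_x: "expressible target_x"
  unfolding target_x_def by (intro expressible_intros expressible_mem_dim expressible_mem_target)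

lemma expressible_target_y: "expressible target_y"
  unfolding target_y_def by (intro expressible_intros expressible_mem_dim expressible_mem_target)

lemma expressible_target_z: "expressible target_z"
  unfolding target_z_def by (intro expressible_intros expressible_mem_target expressible_target_x expressible_target_y)

lemma expressible_guess_x: "expressible guess_x"
  unfolding guess_x_def by (intro expressible_intros)

lemma expressible_guess_y: "expressible guess_y"
  unfolding guess_y_def by (intro expressible_intros)

lemma expressible_guess_cell: "expressible guess_cell"
  unfolding guess_cell_def by (intro expressible_intros)

lemma expressible_guess_dist: "expressible guess_dist"
  unfolding guess_dist_def by (intro expressible_intros)

lemma expressible_guess_z: "expressible guess_z"
  unfolding guess_z_def by (intro expressible_intros expressible_guess_x expressible_guess_y expressible_guess_cell)

lemma expressible_guess_active: "expressible_pred guess_active"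
  unfolding guess_active_def by (intro expressible_intros expressible_mem_dim expressible_mem_cells expressible_guess_x expressible_guess_y expressible_guess_cell)

lemma expressible_actual_dist: "expressible actual_dist"
  unfolding actual_dist_def by (intro expressible_intros expressible_target_x expressible_target_y expressible_target_z expressible_guess_x expressible_guess_y expressible_guess_z expressible_gap)

lemma expressible_nearest: "expressible_pred nearest"
  unfolding nearest_def by (intro expressible_intros expressible_guess_active expressible_actual_dist)

lemma expressible_accepting: "expressible_pred accepting"
  unfolding accepting_def by (intro expressible_intros expressible_mem_dim expressible_mem_target)

lemmas expressible_computations = expressible_intros expressible_gap expressible_pred_side
  expressible_mem_dim expressible_mem_cells expressible_mem_target expressible_target_x expressible_target_y expressible_target_z expressible_guess_x expressible_guess_y expressible_guess_cell expressible_guess_dist expressible_guess_z expressible_guess_active expressible_actual_dist expressible_nearest expressible_accepting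

lemma straight_line_stability_program: "straight_line stability_program"
proof -
  have 1: "straight_line find_dim"
    unfolding find_dim_def by (intro straight_line_write_first expressible_computations) simp
  have 2: "straight_line find_target"
    unfolding find_target_def by (intro straight_line_write_first expressible_computations) simp
  have 3: "straight_line find_flaw"
    unfolding find_flaw_def by (intro straight_line_write_first expressible_computations) simp
  have 4: "straight_line find_dist"
    unfolding find_dist_def by (intro straight_line_write_first expressible_computations) simp
  have 5: "straight_line find_x"
    unfolding find_x_def by (intro straight_line_write_first expressible_computations) simp
  have 6: "straight_line find_y"
    unfolding find_y_def by (intro straight_line_write_first expressible_computations) simp
  have 7: "straight_line find_z"
    unfolding find_z_def by (intro straight_line_write_first expressible_computations) simp
  have 8: "straight_line give_answer"
    unfolding give_answer_def by (intro straight_line_par_write expressible_computations)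
  note comp = straight_line_comp
  show ?thesis
    unfolding stability_program_def[abs_def]
    by (rule comp[OF comp[OF comp[OF comp[OF comp[OF comp[OF comp[OF 1 2] 3] 4] 5] 6] 7] 8])
qed

section \<open>Correctness of the program\<close>

lemma write_first_at:
  "write_first k Q V P l m (l + k) =
     (if \<exists>p<P. Q m p l then V m (LEAST p. p < P \<and> Q m p l) l else m (l + k))"
  by (auto simp: write_first_def)

lemma write_first_other: "a \<noteq> l + k \<Longrightarrow> write_first k Q V P l m a = m a"
  by (simp add: write_first_def)

text \<open>The quadruples need \<open>8 * l ^ 4\<close> processors, and
  \<open>8 \<le> (l + 1) ^ 2\<close> for \<open>2 \<le> l\<close>; hence the exponent 6.\<close>

lemma ex_guess:
  assumes "I < 2 * l" "J < 2 * l" "q < 2 * l" "d < l" "2 \<le> l"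
  shows "\<exists>p<(l + 1) ^ 6. guess_x m p l = I \<and> guess_y m p l = J \<and> guess_cell m p l = q \<and>
           guess_dist m p l = d"
proof -
  let ?B = "2 * l"
  let ?p = "I + ?B * (J + ?B * (q + ?B * d))"
  have digit: "(r + b * s) mod b = r \<and> (r + b * s) div b = s" if "r < b" for r s b :: nat
    using that by simp
  have p: "guess_x m ?p l = I" "guess_y m ?p l = J" "guess_cell m ?p l = q" "guess_dist m ?p l = d"
    unfolding guess_x_def guess_y_def guess_cell_def guess_dist_def
    using digit assms(1-3) by metis+
  have less: "r + b * s < b * t" if "r < b" "s < t" for r b s t :: nat
  proof -
    have "r + b * s < b * Suc s"
      using that by simp
    also have "\<dots> \<le> b * t"
      using that by (intro mult_le_mono2) simp
    finally show ?thesis .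
  qed
  have "?p < ?B * (?B * (?B * l))"
    by (intro less assms)
  also have "\<dots> = 2 * 2 * 2 * l ^ 4"
    by (simp add: power4_eq_xxxx)
  also have "\<dots> \<le> (l + 1) ^ 2 * (l + 1) ^ 4"
  proof (rule mult_le_mono)
    have "(3::nat) ^ 2 \<le> (l + 1) ^ 2"
      using assms by (intro power_mono) auto
    then show "2 * 2 * 2 \<le> (l + 1) ^ 2"
      by simp
  qed (simp add: power_mono)
  also have "\<dots> = (l + 1) ^ 6"
    by (simp add: power_add[symmetric])
  finally show ?thesis
    using p by blast
qed

text \<open>Since \<open>4 * p * p + p = p * (4 * p + 1)\<close>, dividing \<open>l - 1\<close> by
  \<open>p\<close> tests the length without a product of variables.\<close>

lemma dim_iff:
  "0 < p \<and> (l - 1) mod p = 0 \<and> (l - 1) div p = 4 * p + 1 \<longleftrightarrow> 0 < p \<and> l = 4 * p * p + p + 1"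
  for p l :: nat
proof (cases "l = 0 \<or> p = 0")
  case False
  have "(l - 1) mod p = 0 \<and> (l - 1) div p = 4 * p + 1 \<longleftrightarrow> l - 1 = p * (4 * p + 1)"
    using False by (metis add.right_neutral bot_nat_0.not_eq_extremum mod_mult_self1_is_0 mult_div_mod_eq nonzero_mult_div_cancel_left)
  then show ?thesis
    using False by (auto simp: algebra_simps)
qed auto

lemma dim_unique:
  assumes "4 * n * n + n = 4 * n' * n' + n'"
  shows "n = (n' :: nat)"
proof (rule ccontr)
  have less: "4 * a * a + a < 4 * b * b + b" if "a < b" for a b :: nat
    using that by (intro add_le_less_mono mult_le_mono) auto
  assume "n \<noteq> n'"
  then show False
    using less[of n n'] less[of n' n] assms by linarith
qed

text \<open>The criterion quantifies over the infinite plane, but only active cells at distance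
  \<open>Suc d \<le> 4 * n\<close> matter, and these lie in the window that is searched.\<close>

lemma stable_iff_active_cell:
  assumes "k < 2 * n * n" "\<not> near (word_config n w) d (cell_at n k)"
    "near (word_config n w) (Suc d) (cell_at n k)" "Suc d \<le> 4 * n"
  shows "stable {1, 2} (word_config n w) (cell_at n k) \<longleftrightarrow>
    (\<forall>f\<in>{cell_x, cell_y, cell_z}. \<exists>I<9 * n. \<exists>J<9 * n. \<exists>q. active_cell n w I J q \<and>
       cell_dist (cell_at n k) (shifted_cell n I J q) = Suc d \<and>
       toward f (cell_at n k) (shifted_cell n I J q))"
proof -
  have "(\<exists>a. word_config n w a \<and> cell_dist (cell_at n k) a = Suc d \<and> toward f (cell_at n k) a) \<longleftrightarrow>
    (\<exists>I<9 * n. \<exists>J<9 * n. \<exists>q. active_cell n w I J q \<and>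
       cell_dist (cell_at n k) (shifted_cell n I J q) = Suc d \<and>
       toward f (cell_at n k) (shifted_cell n I J q))" (is "?L \<longleftrightarrow> ?R") for f
  proof
    assume ?L
    then obtain a where a: "word_config n w a" "cell_dist (cell_at n k) a = Suc d"
      "toward f (cell_at n k) a"
      by blast
    with assms(4) have "cell_dist (cell_at n k) a \<le> 4 * n"
      by simp
    from active_within_cases[OF a(1) assms(1) this] a show ?R
      by metis
  next
    assume ?R
    then show ?L
      using active_cell_word_config by blast
  qed
  then show ?thesis
    unfolding stable_12_iff[OF assms(3,2)] neighbors_near_iff[OF assms(2)] by simp
qed

section \<open>Meaning of the memory contents\<close>

context
  fixes n k l :: nat and w :: "bool list" and m :: "nat \<Rightarrow> nat"
  assumes l: "length w = l" "l = 4 * n * n + n + 1"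
    and n: "0 < n"
    and input: "\<forall>i<l. m i = of_bool (w ! i)"
    and dim: "m (l + 3) = n"
begin

lemma mem_dim_eq: "mem_dim m p l = n"
  by (simp add: mem_dim_def dim)

lemma mem_cells_eq: "mem_cells m p l = 2 * n * n"
  unfolding mem_cells_def mem_dim_eq using l by simp

lemma guess_active_iff:
  "guess_active m p l \<longleftrightarrow> active_cell n w (guess_x m p l) (guess_y m p l) (guess_cell m p l)"
proof -
  have "m (n + 1 + q) = 1 \<longleftrightarrow> w ! (n + 1 + q)" if "q < 2 * n * n" for q
    using input[rule_format, of "n + 1 + q"] that l by simp
  then show ?thesis
    unfolding guess_active_def active_cell_def mem_dim_eq mem_cells_eq by blast
qed

lemma marker_iff:
  "q < 2 * n * n \<Longrightarrow> m (n + 1 + 2 * n * n + q) = 1 \<longleftrightarrow> w ! (n + 1 + 2 * n * n + q)"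
  using input[rule_format, of "n + 1 + 2 * n * n + q"] l by simp

context
  assumes target: "m (l + 4) = k + 1"
begin

lemma mem_target_eq: "mem_target m p l = k"
  by (simp add: mem_target_def target)

lemma cell_at_eq_target: "cell_at n k = shifted_cell n (target_x m p l) (target_y m p l) k"
  by (simp add: cell_at_eq_shifted_cell target_x_def target_y_def mem_target_eq mem_dim_eq)

lemma actual_dist_eq:
  "actual_dist m p l =
     cell_dist (cell_at n k) (shifted_cell n (guess_x m p l) (guess_y m p l) (guess_cell m p l))"
  unfolding cell_at_eq_target[of p] cell_dist_shifted_cell actual_dist_def target_z_def guess_z_def
    mem_target_eq ..

lemma side_iff_toward:
  fixes p :: nat
  defines "a \<equiv> shifted_cell n (guess_x m p l) (guess_y m p l) (guess_cell m p l)"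
  shows "side (mem_target m p l) (guess_x m p l) (target_x m p l) \<longleftrightarrow> toward cell_x (cell_at n k) a"
    "side (mem_target m p l) (guess_y m p l) (target_y m p l) \<longleftrightarrow> toward cell_y (cell_at n k) a"
    "side (mem_target m p l) (target_z m p l) (guess_z m p l) \<longleftrightarrow> toward cell_z (cell_at n k) a"
  unfolding a_def cell_at_eq_target[of p] toward_shifted_cell target_z_def guess_z_def mem_target_eq
  by (rule refl)+

end

end

lemma stability_program_correct:
  "stability_program ((length w + 1) ^ 6) (length w) (mem (pram_init w)) 0 = 1 \<longleftrightarrow>
     w \<in> STABILITY {1, 2}"
proof -
  define l P where "l = length w" and "P = (l + 1) ^ 6"
  define m0 where "m0 = mem (pram_init w)"
  define m1 where "m1 = find_dim P l m0"
  define m2 where "m2 = find_target P l m1"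
  define m3 where "m3 = find_flaw P l m2"
  define m4 where "m4 = find_dist P l m3"
  define m5 where "m5 = find_x P l m4"
  define m6 where "m6 = find_y P l m5"
  define m7 where "m7 = find_z P l m6"
  have m0: "m0 a = of_bool (a < l \<and> w ! a)" for a
    by (simp add: m0_def pram_init_def l_def)
  have m1: "m1 a = m0 a" if "a \<noteq> l + 3" for a
    using that by (simp add: m1_def find_dim_def write_first_other)
  have m2: "m2 a = m1 a" if "a \<noteq> l + 4" for a
    using that by (simp add: m2_def find_target_def write_first_other)
  have m3: "m3 a = m2 a" if "a \<noteq> l + 5" for a
    using that by (simp add: m3_def find_flaw_def write_first_other)
  have m4: "m4 a = m3 a" if "a \<noteq> l + 6" for a
    using that by (simp add: m4_def find_dist_def write_first_other)
  have m5: "m5 a = m4 a" if "a \<noteq> l + 7" for a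
    using that by (simp add: m5_def find_x_def write_first_other)
  have m6: "m6 a = m5 a" if "a \<noteq> l + 8" for a
    using that by (simp add: m6_def find_y_def write_first_other)
  have m7: "m7 a = m6 a" if "a \<noteq> l + 9" for a
    using that by (simp add: m7_def find_z_def write_first_other)
  note mem = m0 m1 m2 m3 m4 m5 m6 m7
  have le_P: "a < P" if "a \<le> l" for a
  proof -
    have "(l + 1) ^ 1 \<le> P"
      unfolding P_def by (rule power_increasing) simp_all
    with that show ?thesis
      by simp
  qed
  \<comment> \<open>\<open>accepting\<close> has the same value for all processors, so the least
    writer gives the common answer.\<close>
  have answer: "stability_program P l m0 0 = 1 \<longleftrightarrow> accepting m7 0 l"
    using le_P[of 0]
    by (auto simp: stability_program_def m1_def m2_def m3_def m4_def m5_def m6_def m7_def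
        give_answer_def par_write_def accepting_def mem_dim_def mem_target_def)
  \<comment> \<open>The default 0 is the initial content behind the input.\<close>
  have m1_dim: "m1 (l + 3) = (if \<exists>p<P. 0 < p \<and> l = 4 * p * p + p + 1
      then LEAST p. p < P \<and> 0 < p \<and> l = 4 * p * p + p + 1 else 0)"
    unfolding m1_def find_dim_def write_first_at dim_iff by (auto simp: m0)
  have "accepting m7 0 l \<longleftrightarrow> w \<in> STABILITY {1, 2}"
  proof (cases "\<exists>n>0. l = 4 * n * n + n + 1")
    case False
    then have "\<not> (\<exists>p<P. 0 < p \<and> l = 4 * p * p + p + 1)"
      by blast
    then have "m1 (l + 3) = 0"
      unfolding m1_dim by (rule if_not_P)
    then have "mem_dim m7 0 l = 0"
      by (simp add: mem_dim_def m2 m3 m4 m5 m6 m7)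
    then have "\<not> accepting m7 0 l"
      unfolding accepting_def by blast
    moreover have "w \<notin> STABILITY {1, 2}"
      using False unfolding STABILITY_iff l_def by blast
    ultimately show ?thesis
      by blast
  next
    case True
    then obtain n where n: "0 < n" "l = 4 * n * n + n + 1"
      by blast
    have uniq: "0 < n' \<and> l = 4 * n' * n' + n' + 1 \<longleftrightarrow> n' = n" for n'
      using n dim_unique[of n n'] by auto
    have "n < P"
      using le_P[of n] n by simp
    then have dim: "m1 (l + 3) = n"
      unfolding m1_dim uniq by (auto intro: Least_equality)
    let ?M = "2 * n * n"
    have M_le: "?M \<le> l"
      using n by simp
    define mark where "mark q \<longleftrightarrow> w ! (n + 1 + ?M + q)" for q
    have input: "\<forall>i<l. m1 i = of_bool (w ! i)" "\<forall>i<l. m2 i = of_bool (w ! i)"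
      "\<forall>i<l. m3 i = of_bool (w ! i)" "\<forall>i<l. m4 i = of_bool (w ! i)"
      "\<forall>i<l. m5 i = of_bool (w ! i)" "\<forall>i<l. m6 i = of_bool (w ! i)"
      "\<forall>i<l. m7 i = of_bool (w ! i)"
      by (simp_all add: mem)
    have dims: "m2 (l + 3) = n" "m3 (l + 3) = n" "m4 (l + 3) = n" "m5 (l + 3) = n"
      "m6 (l + 3) = n" "m7 (l + 3) = n"
      by (simp_all add: m2 m3 m4 m5 m6 m7 dim)
    note ctx = l_def[symmetric] n(2,1)
    note facts1 = ctx input(1) dim
    have stab: "w \<in> STABILITY {1, 2} \<longleftrightarrow> (\<forall>i<n. w ! i) \<and> \<not> w ! n \<and>
       (\<exists>k<?M. (\<forall>q<?M. mark q = (q = k)) \<and> \<not> w ! (n + 1 + k) \<and>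
         stable {1, 2} (word_config n w) (cell_at n k))"
    proof -
      have len: "0 < n' \<and> length w = 4 * n' * n' + n' + 1 \<longleftrightarrow> n' = n" for n'
        unfolding l_def[symmetric] by (rule uniq)
      have only_n: "(\<exists>n' k. 0 < n' \<and> length w = 4 * n' * n' + n' + 1 \<and> Q n' k) \<longleftrightarrow>
          (\<exists>k. Q n k)" for Q
        unfolding conj_assoc[symmetric] len by simp
      show ?thesis
        unfolding STABILITY_iff only_n mark_def by blast
    qed
    have m2_target: "m2 (l + 4) = (if \<exists>p<P. p < ?M \<and> mark p
        then (LEAST p. p < P \<and> p < ?M \<and> mark p) + 1 else 0)"
      unfolding m2_def find_target_def write_first_at mem_dim_eq[OF facts1] mem_cells_eq[OF facts1]
      using marker_iff[OF facts1] by (simp add: mark_def m1 m0 cong: conj_cong)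
    show ?thesis
    proof (cases "\<exists>q<?M. mark q")
      case False
      then have "m2 (l + 4) = 0"
        unfolding m2_target by auto
      then have "m7 (l + 4) = 0"
        by (simp add: m3 m4 m5 m6 m7)
      then have "\<not> accepting m7 0 l"
        unfolding accepting_def by blast
      moreover have "w \<notin> STABILITY {1, 2}"
        using False unfolding stab by blast
      ultimately show ?thesis
        by blast
    next
      case True
      define k where "k = (LEAST p. p < P \<and> p < ?M \<and> mark p)"
      have ex: "\<exists>p<P. p < ?M \<and> mark p"
        using True le_P M_le by (meson less_imp_le order.trans)
      then have k: "k < ?M" "mark k"
        using LeastI_ex[OF ex] unfolding k_def by blast+
      have target: "m2 (l + 4) = k + 1"
        using ex unfolding m2_target k_def by simp
      have targets: "m3 (l + 4) = k + 1" "m4 (l + 4) = k + 1" "m5 (l + 4) = k + 1"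
        "m6 (l + 4) = k + 1" "m7 (l + 4) = k + 1"
        by (simp_all add: m3 m4 m5 m6 m7 target)
      note facts2 = ctx input(2) dims(1)
      note facts3 = ctx input(3) dims(2)
      note facts4 = ctx input(4) dims(3)
      note facts5 = ctx input(5) dims(4)
      note facts6 = ctx input(6) dims(5)
      note facts7 = ctx input(7) dims(6)
      let ?flaw = "\<lambda>p. p < n \<and> \<not> w ! p \<or> p = n \<and> w ! p \<or> p < ?M \<and> mark p \<and> \<not> p = k"
      define flawed where "flawed \<longleftrightarrow> (\<exists>p<P. ?flaw p)"
      have flaw: "m3 (l + 5) = (if flawed then 1 else 0)"
      proof -
        have *: "p < n \<and> m2 p = 0 \<or> p = n \<and> m2 p = 1 \<or>
            p < ?M \<and> m2 (n + 1 + ?M + p) = 1 \<and> \<not> p = k \<longleftrightarrow> ?flaw p" for p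
          using marker_iff[OF facts2, of p] input(2)[rule_format, of p] n unfolding mark_def by auto
        have **: "m2 (l + 5) = 0"
          by (simp add: m2 m1 m0)
        show ?thesis
          unfolding m3_def find_flaw_def write_first_at mem_dim_eq[OF facts2]
            mem_cells_eq[OF facts2] mem_target_eq[OF facts2 target] flawed_def * ** ..
      qed
      have flaw_iff: "flawed \<longleftrightarrow> \<not> ((\<forall>i<n. w ! i) \<and> \<not> w ! n \<and> (\<forall>q<?M. mark q = (q = k)))"
      proof -
        have "?flaw p \<Longrightarrow> p < P" for p
          using le_P[of p] n M_le by auto
        then show ?thesis
          unfolding flawed_def
          using k by blast
      qed
      have stab_k: "w \<in> STABILITY {1, 2} \<longleftrightarrow> \<not> flawed \<and> \<not> w ! (n + 1 + k) \<and>
         stable {1, 2} (word_config n w) (cell_at n k)"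
        unfolding stab flaw_iff using k by blast
      have acc: "accepting m7 0 l \<longleftrightarrow> \<not> flawed \<and> \<not> w ! (n + 1 + k) \<and>
        (m4 (l + 6) = 0 \<or> m5 (l + 7) = 1 \<and> m6 (l + 8) = 1 \<and> m7 (l + 9) = 1)"
      proof -
        have "m7 (l + 5) = m3 (l + 5)" "m7 (l + 6) = m4 (l + 6)" "m7 (l + 7) = m5 (l + 7)"
          "m7 (l + 8) = m6 (l + 8)"
          by (simp_all add: m4 m5 m6 m7)
        moreover have "m7 (n + 1 + k) = of_bool (w ! (n + 1 + k))"
          using k n input(7) by simp
        ultimately show ?thesis
          using n(1) unfolding accepting_def mem_dim_eq[OF facts7] mem_target_eq[OF facts7 targets(5)]
            targets(5) flaw by (simp split: if_splits)
      qed
      show ?thesis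
      proof (cases "w ! (n + 1 + k)")
        case True
        then show ?thesis
          using acc stab_k by blast
      next
        case inactive: False
        let ?c = "word_config n w"
        let ?u = "cell_at n k"
        define gx gy gq gd where "gx p = guess_x m3 p l" and "gy p = guess_y m3 p l"
          and "gq p = guess_cell m3 p l" and "gd p = guess_dist m3 p l" for p
        define act where "act p \<longleftrightarrow> active_cell n w (gx p) (gy p) (gq p)" for p
        define a where "a p = shifted_cell n (gx p) (gy p) (gq p)" for p
        note guess_defs = gx_def gy_def gq_def gd_def guess_x_def guess_y_def guess_cell_def guess_dist_def
        \<comment> \<open>By \<open>n \<le> n * n\<close>, coordinates, cell numbers and distances
          fit into their digits.\<close>
        have l_ge: "2 \<le> l" "9 * n \<le> 2 * l" "?M \<le> 2 * l" "4 * n < l"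
          using n le_square[of n] unfolding mult.assoc by linarith+
        have ex_p: "\<exists>p<P. gx p = I \<and> gy p = J \<and> gq p = q \<and> gd p = d"
          if "I < 9 * n" "J < 9 * n" "active_cell n w I J q" "d \<le> 4 * n" for I J q d
        proof -
          have "q < ?M"
            using that(3) by (simp add: active_cell_def)
          then have "I < 2 * l" "J < 2 * l" "q < 2 * l" "d < l" "2 \<le> l"
            using that l_ge by linarith+
          then show ?thesis
            unfolding P_def gx_def gy_def gq_def gd_def by (rule ex_guess)
        qed
        have m3_dist: "m3 (l + 6) = 0"
          by (simp add: mem)
        have m4_dist: "m4 (l + 6) = (if \<exists>p<P. act p \<and> cell_dist ?u (a p) = gd p
            then gd (LEAST p. p < P \<and> act p \<and> cell_dist ?u (a p) = gd p) + 1 else 0)"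
          unfolding m4_def find_dist_def write_first_at guess_active_iff[OF facts3]
            actual_dist_eq[OF facts3 targets(1)] act_def a_def gx_def gy_def gq_def gd_def
            m3_dist ..
        show ?thesis
        proof (cases "\<exists>q<?M. w ! (n + 1 + q)")
          case False
          then have "\<not> act p" for p
            unfolding act_def active_cell_def by blast
          then have "m4 (l + 6) = 0"
            unfolding m4_dist by simp
          moreover have "\<not> ?c v" for v
            using False cell_cases_cell_of[of v] word_config_cell_of by metis
          then have "stable {1, 2} ?c ?u"
            by (rule stable_12_no_active)
          ultimately show ?thesis
            using acc stab_k by blast
        next
          case True
          then have near: "near ?c (4 * n) ?u"
            using active_near_cell_at k(1) by blast
          define e where "e = (LEAST d. near ?c d ?u)"
          have e: "near ?c e ?u" "e \<le> 4 * n" "\<And>d. d < e \<Longrightarrow> \<not> near ?c d ?u"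
            using near unfolding e_def by (auto intro: LeastI Least_le dest: not_less_Least)
          have not_c: "\<not> ?c ?u"
          proof
            assume "?c ?u"
            then obtain q where q: "q < ?M" "w ! (n + 1 + q)" "q mod 2 = k mod 2"
              "int (q div (2 * n)) = int (k div (2 * n)) mod int n"
              "int (q mod (2 * n) div 2) = int (k mod (2 * n) div 2) mod int n"
              unfolding cell_at_def word_config_cell_of by blast
            then have "cell_at n q = cell_at n k"
              using cell_at_less[OF k(1)] by (simp add: cell_at_def cell_of_eq_iff zmod_int[symmetric])
            then have "q = k"
              using inj_cell_at by (auto dest: injD)
            with q(2) inactive show False
              by simp
          qed
          then have "e \<noteq> 0"
            using e(1) unfolding near_def by (metis cell_dist_eq_0 le_zero_eq)
          then obtain d where d: "e = Suc d"
            by (cases e) auto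
          have dist_ge: "e \<le> cell_dist ?u v" if "?c v" for v
            using e(3)[of "cell_dist ?u v"] that unfolding near_def by (meson not_less order_refl)
          have act_c: "?c (a p)" if "act p" for p
            using that active_cell_word_config unfolding act_def a_def by blast
          obtain v where v: "?c v" "cell_dist ?u v = e"
            using e(1) dist_ge unfolding near_def by (meson le_antisym)
          obtain I J q where "active_cell n w I J q" "v = shifted_cell n I J q" "I < 9 * n" "J < 9 * n"
            using active_within_cases[OF v(1) k(1)] v(2) e(2) by metis
          \<comment> \<open>A nearest active cell together with its true distance is a successful
            guess.\<close>
          with ex_p[of I J q e] v(2) e(2)
          obtain p where p: "p < P" "act p" "cell_dist ?u (a p) = gd p" "gd p = e"
            unfolding act_def a_def by metis
          define p0 where "p0 = (LEAST p. p < P \<and> act p \<and> cell_dist ?u (a p) = gd p)"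
          have p0: "act p0" "cell_dist ?u (a p0) = gd p0" "p0 \<le> p"
            using LeastI[of "\<lambda>p. p < P \<and> act p \<and> cell_dist ?u (a p) = gd p" p]
              Least_le[of "\<lambda>p. p < P \<and> act p \<and> cell_dist ?u (a p) = gd p" p] p
            unfolding p0_def by blast+
          \<comment> \<open>The distance is the leading digit, hence monotone in the processor
            number. The other inequality holds because the guessed cell is active.\<close>
          have "gd p0 \<le> gd p"
            using p0(3) unfolding gd_def guess_dist_def by (intro div_le_mono)
          then have "gd p0 = e"
            using dist_ge[OF act_c[OF p0(1)]] p0(2) p(4) by simp
          then have dist: "m4 (l + 6) = e + 1"
            using p unfolding m4_dist p0_def by auto
          then have dists: "m5 (l + 6) = e + 1" "m6 (l + 6) = e + 1"
            by (simp_all add: m5 m6)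
          \<comment> \<open>Guesses depend only on \<open>p\<close> and \<open>l\<close>, so they
            agree for all memories.\<close>
          have guess_eq: "guess_x m p l = gx p" "guess_y m p l = gy p" "guess_cell m p l = gq p" for m p
            by (simp_all add: guess_defs)
          have m5_flag: "m5 (l + 7) = 1 \<longleftrightarrow>
            (\<exists>p<P. (act p \<and> cell_dist ?u (a p) + 1 = e + 1) \<and> toward cell_x ?u (a p))"
            unfolding m5_def find_x_def write_first_at nearest_def guess_active_iff[OF facts4]
              actual_dist_eq[OF facts4 targets(2)] side_iff_toward[OF facts4 targets(2)]
            unfolding guess_eq dist act_def[symmetric] a_def[symmetric] by (auto simp: mem)
          have m6_flag: "m6 (l + 8) = 1 \<longleftrightarrow>
            (\<exists>p<P. (act p \<and> cell_dist ?u (a p) + 1 = e + 1) \<and> toward cell_y ?u (a p))"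
            unfolding m6_def find_y_def write_first_at nearest_def guess_active_iff[OF facts5]
              actual_dist_eq[OF facts5 targets(3)] side_iff_toward[OF facts5 targets(3)]
            unfolding guess_eq dists act_def[symmetric] a_def[symmetric] by (auto simp: mem)
          have m7_flag: "m7 (l + 9) = 1 \<longleftrightarrow>
            (\<exists>p<P. (act p \<and> cell_dist ?u (a p) + 1 = e + 1) \<and> toward cell_z ?u (a p))"
            unfolding m7_def find_z_def write_first_at nearest_def guess_active_iff[OF facts6]
              actual_dist_eq[OF facts6 targets(4)] side_iff_toward[OF facts6 targets(4)]
            unfolding guess_eq dists act_def[symmetric] a_def[symmetric] by (auto simp: mem)
          have flag_iff: "(\<exists>p<P. (act p \<and> cell_dist ?u (a p) + 1 = e + 1) \<and> toward f ?u (a p)) \<longleftrightarrow>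
            (\<exists>I<9 * n. \<exists>J<9 * n. \<exists>q. active_cell n w I J q \<and>
               cell_dist ?u (shifted_cell n I J q) = Suc d \<and> toward f ?u (shifted_cell n I J q))"
            (is "?L \<longleftrightarrow> ?R") for f
          proof
            assume ?L
            then obtain p where p: "act p" "cell_dist ?u (a p) = e" "toward f ?u (a p)"
              by auto
            \<comment> \<open>Digits range up to \<open>2 * l\<close>; it is the distance bound that
              confines the coordinates to the window.\<close>
            have "cell_dist ?u (a p) \<le> 4 * n"
              using p(2) e(2) by simp
            from active_within_cases[OF act_c[OF p(1)] k(1) this] p d show ?R
              by metis
          next
            assume ?R
            then obtain I J q where "I < 9 * n" "J < 9 * n" "active_cell n w I J q"
              "cell_dist ?u (shifted_cell n I J q) = Suc d" "toward f ?u (shifted_cell n I J q)"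
              by blast
            \<comment> \<open>The flags compare the actual distance with the stored one, so any
              guessed distance will do; 0 is chosen.\<close>
            with ex_p[of I J q 0] show ?L
              unfolding act_def a_def d by (metis add.commute le0)
          qed
          have "m5 (l + 7) = 1 \<and> m6 (l + 8) = 1 \<and> m7 (l + 9) = 1 \<longleftrightarrow> stable {1, 2} ?c ?u"
            unfolding m5_flag m6_flag m7_flag flag_iff
            using stable_iff_active_cell[OF k(1) e(3)[of d] e(1)[unfolded d] e(2)[unfolded d]] d
            by simp
          then show ?thesis
            unfolding acc stab_k dist by simp
        qed
      qed
    qed
  qed
  with answer show ?thesis
    unfolding l_def P_def m0_def by simp
qed

theorem theorem3: "STABILITY {1, 2} \<in> NC"
  by (rule straight_line_imp_NC[OF straight_line_stability_program _ stability_program_correct]) simp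

end
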